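(* Let $\{U(t)\}_{t\in\mathbb{R}}$ be a $C_0$-group on a complex Banach space $\mathfrak{X}$ with generator $iA$, satisfying $\int_{-\infty}^{\infty}\frac{\ln\|U(t)\|}{1+t^2}\,dt<\infty$. Let $\omega(t)$, $t\in\mathbb{R}_+=[0,\infty)$, be a (real-valued) function of the type of a module of continuity, meaning that the following conditions are satisfied: (1) $\omega$ is continuous and nondecreasing for $t\in\mathbb{R}_+$; (2) $\omega(0)=0$; (3) there is $c>0$ such that $\omega(2t)\le c\,\omega(t)$ for all $t\in[0,1]$; (4) $\int_0^1\frac{\omega(t)}{t}\,dt<\infty$. If, for $x\in\mathfrak{X}$, there exist $n\in\mathbb{N}$ and $m>0$ such that $$\mathcal{E}_r(x,A)\le\frac{m}{r^n}\,\omega\left(\frac1r\right)\qquad\text{for all } r\ge1,$$ then $x\in\mathcal{D}(A^n)$ and for every $k\in\mathbb{N}$ there exists a constant $m_k>0$ such that $$\omega_k(t,A^nx,A)\le m_k\left(t^k\int_t^1\frac{\omega(u)}{u^{k+1}}\,du+\int_0^t\frac{\omega(u)}{u}\,du\right),\qquad 0<t\le\frac12.$$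
   Context: Setting: $(\mathfrak{X},\|\cdot\|)$ is a complex Banach space, $A$ is a closed densely defined linear operator with domain $\mathcal{D}(A)$, and $iA$ generates the strongly continuous group $\{U(t)\}_{t\in\mathbb{R}}$. Here $\mathbb{N}=\{1,2,\dots\}$, $\mathbb{N}_0=\mathbb{N}\cup\{0\}$. Definitions: $C^\infty(A)=\bigcap_{n\in\mathbb{N}_0}\mathcal{D}(A^n)$; for $\alpha>0$, $\mathfrak{E}^{\alpha}(A)=\{x\in C^\infty(A): \exists c=c(x)>0\ \forall k\in\mathbb{N}_0\ \|A^kx\|\le c\alpha^k\}$; $\mathfrak{E}(A)=\bigcup_{\alpha>0}\mathfrak{E}^\alpha(A)$. The type of $x\in\mathfrak{E}(A)$ is $\sigma(x,A)=\inf\{\alpha>0: x\in\mathfrak{E}^\alpha(A)\}=\limsup_{n\to\infty}\|A^nx\|^{1/n}$, and $\Xi^r(A)=\{y\in\mathfrak{E}(A):\sigma(y,A)\le r\}$ for $r>0$. The best approximation of $x\in\mathfrak{X}$ is $\mathcal{E}_r(x,A)=\inf_{y\in\Xi^r(A)}\|x-y\|$, $r>0$. The $k$-th module of continuity is $\omega_k(t,x,A)=\sup_{0\le\tau\le t}\|\Delta_\tau^kx\|$ for $t\ge0$, where $\Delta_h^k=(U(h)-I)^k$ and $I$ is the identity operator.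
   Formalization: The formal theorem additionally assumes that ω does not vanish identically on [0,1]; conditions (1)–(4) allow ω = 0, and then the claim fails (X = ℂ, U(t) = e^{it}, A = 1, x = 1). *)

theory Defs
  imports "HOL-Analysis.Analysis"
begin

(* The real structure (scaleR, norm, topology) is inherited from the library; the law
   1 *C x = x is a consequence of scaleR_scaleC. *)
class complex_normed_vector = real_normed_vector +
  fixes scaleC :: "complex \<Rightarrow> 'a \<Rightarrow> 'a"  (infixr "*C" 75)
  assumes scaleC_add_right: "c *C (x + y) = c *C x + c *C y"
    and scaleC_add_left: "(c + d) *C x = c *C x + d *C x"
    and scaleC_scaleC: "c *C (d *C x) = (c * d) *C x"
    and scaleR_scaleC: "r *\<^sub>R x = complex_of_real r *C x"
    and norm_scaleC: "norm (c *C x) = cmod c * norm x"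

class complex_banach = complex_normed_vector + banach

(* An unbounded operator is given by its domain D and a total function A, of which only the
   values on D are meaningful. *)
definition closed_densely_defined :: "'a::complex_banach set \<Rightarrow> ('a \<Rightarrow> 'a) \<Rightarrow> bool" where
  "closed_densely_defined D A \<longleftrightarrow>
     (\<forall>x\<in>D. \<forall>y\<in>D. x + y \<in> D \<and> A (x + y) = A x + A y) \<and>
     (\<forall>c. \<forall>x\<in>D. c *C x \<in> D \<and> A (c *C x) = c *C A x) \<and>
     closed {(x, A x) | x. x \<in> D} \<and>
     closure D = UNIV"

definition c0_group :: "(real \<Rightarrow> 'a::complex_banach \<Rightarrow> 'a) \<Rightarrow> bool" where
  "c0_group U \<longleftrightarrow>
     (\<forall>t. bounded_linear (U t) \<and> (\<forall>c x. U t (c *C x) = c *C U t x)) \<and>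
     (\<forall>x. U 0 x = x) \<and>
     (\<forall>s t x. U (s + t) x = U s (U t x)) \<and>
     (\<forall>x. continuous_on UNIV (\<lambda>t. U t x))"

definition is_generator ::
    "'a::complex_banach set \<Rightarrow> ('a \<Rightarrow> 'a) \<Rightarrow> (real \<Rightarrow> 'a \<Rightarrow> 'a) \<Rightarrow> bool" where
  "is_generator D B U \<longleftrightarrow>
     D = {x. \<exists>y. ((\<lambda>t. (U t x - x) /\<^sub>R t) \<longlongrightarrow> y) (at 0)} \<and>
     (\<forall>x\<in>D. ((\<lambda>t. (U t x - x) /\<^sub>R t) \<longlongrightarrow> B x) (at 0))"

(* The domain of the n-th power of (D, A); on it, that power is A ^^ n. *)
primrec dom_pow :: "'a set \<Rightarrow> ('a \<Rightarrow> 'a) \<Rightarrow> nat \<Rightarrow> 'a set" where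
  "dom_pow D A 0 = UNIV"
| "dom_pow D A (Suc n) = {x \<in> dom_pow D A n. (A ^^ n) x \<in> D}"

definition C_infty :: "'a set \<Rightarrow> ('a \<Rightarrow> 'a) \<Rightarrow> 'a set" where
  "C_infty D A = (\<Inter>n. dom_pow D A n)"

definition exp_type_le :: "real \<Rightarrow> 'a::complex_banach set \<Rightarrow> ('a \<Rightarrow> 'a) \<Rightarrow> 'a set" where
  "exp_type_le \<alpha> D A = {x \<in> C_infty D A. \<exists>c>0. \<forall>k. norm ((A ^^ k) x) \<le> c * \<alpha> ^ k}"

definition exp_type_vectors :: "'a::complex_banach set \<Rightarrow> ('a \<Rightarrow> 'a) \<Rightarrow> 'a set" where
  "exp_type_vectors D A = (\<Union>\<alpha>\<in>{0<..}. exp_type_le \<alpha> D A)"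

definition exp_type :: "'a::complex_banach \<Rightarrow> 'a set \<Rightarrow> ('a \<Rightarrow> 'a) \<Rightarrow> real" where
  "exp_type x D A = Inf {\<alpha>. \<alpha> > 0 \<and> x \<in> exp_type_le \<alpha> D A}"

definition Xi :: "real \<Rightarrow> 'a::complex_banach set \<Rightarrow> ('a \<Rightarrow> 'a) \<Rightarrow> 'a set" where
  "Xi r D A = {y \<in> exp_type_vectors D A. exp_type y D A \<le> r}"

definition best_approx :: "real \<Rightarrow> 'a::complex_banach \<Rightarrow> 'a set \<Rightarrow> ('a \<Rightarrow> 'a) \<Rightarrow> real" where
  "best_approx r x D A = (INF y\<in>Xi r D A. norm (x - y))"

definition group_diff ::
    "(real \<Rightarrow> 'a::complex_banach \<Rightarrow> 'a) \<Rightarrow> nat \<Rightarrow> real \<Rightarrow> 'a \<Rightarrow> 'a" where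
  "group_diff U k h = (\<lambda>x. U h x - x) ^^ k"

definition modulus_of_continuity ::
    "nat \<Rightarrow> real \<Rightarrow> 'a::complex_banach \<Rightarrow> (real \<Rightarrow> 'a \<Rightarrow> 'a) \<Rightarrow> real" where
  "modulus_of_continuity k t x U = (SUP \<tau>\<in>{0..t}. norm (group_diff U k \<tau> x))"

(* The values of \<omega> on the negative half-line are irrelevant. As \<omega> is nonnegative on
   the positive half-line, finiteness of the integral is Lebesgue integrability.
   These conditions admit functions vanishing on [0, 1], which a theorem bounding a modulus of
   continuity by integrals of \<omega> over [0, 1] has to exclude. *)
definition modulus_type :: "(real \<Rightarrow> real) \<Rightarrow> bool" where
  "modulus_type \<omega> \<longleftrightarrow>
     continuous_on {0..} \<omega> \<and> mono_on {0..} \<omega> \<and>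
     \<omega> 0 = 0 \<and>
     (\<exists>c>0. \<forall>t\<in>{0..1}. \<omega> (2 * t) \<le> c * \<omega> t) \<and>
     set_integrable lborel {0<..1} (\<lambda>t. \<omega> t / t)"

(* Since norm (U t) * norm (U (-t)) >= 1, the negative part of ln (norm (U t)) is dominated by
   the positive part at -t; so the integral of ln (norm (U t)) / (1 + t^2) is well defined and
   smaller than infinity exactly when the integrand is Lebesgue integrable. *)
definition nonquasianalytic :: "(real \<Rightarrow> 'a::complex_banach \<Rightarrow> 'a) \<Rightarrow> bool" where
  "nonquasianalytic U \<longleftrightarrow> integrable lborel (\<lambda>t. ln (onorm (U t)) / (1 + t\<^sup>2))"

end

theory Submission
  imports Defs "HOL-Complex_Analysis.Complex_Analysis"
begin

text \<open>
The proof follows Bernstein's scheme for inverse theorems. Take a nearly best approximation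
\<open>y\<^sub>j\<close> of \<open>x\<close> of exponential type at most \<open>2\<^sup>j\<close> and write \<open>x\<close> as \<open>y\<^sub>0\<close> plus the sum of the
increments \<open>y\<^sub>j\<^sub>+\<^sub>1 - y\<^sub>j\<close>. Each increment has type at most \<open>2 \<cdot> 2\<^sup>j\<close> and norm of order
\<open>2\<^sup>-\<^sup>j\<^sup>n \<omega> (2\<^sup>-\<^sup>j)\<close>. Everything rests on a Bernstein inequality
\<open>\<parallel>A\<^sup>k y\<parallel> \<le> C k! r\<^sup>k \<parallel>y\<parallel>\<close> for \<open>y\<close> of type at most \<open>r \<ge> 1\<close>: it turns the bound on an increment
into a bound of order \<open>2\<^sup>j\<^sup>(\<^sup>i\<^sup>-\<^sup>n\<^sup>) \<omega> (2\<^sup>-\<^sup>j)\<close> for \<open>A\<^sup>i\<close> of it. Since the Dini condition on \<open>\<omega>\<close> makes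
the numbers \<open>\<omega> (2\<^sup>-\<^sup>j)\<close> summable, the series converges after applying \<open>A\<^sup>i\<close> for \<open>i \<le> n\<close>, and as
\<open>A\<close> is closed, \<open>x\<close> lies in the domain of \<open>A\<^sup>n\<close>. For the modulus of continuity at \<open>t\<close>, split the
series at \<open>2\<^sup>-\<^sup>J \<approx> t\<close>: a difference of order \<open>k\<close> costs \<open>t\<^sup>k \<parallel>A\<^sup>k w\<parallel>\<close> on the low frequencies and
a constant factor on the high ones. The two dyadic sums so obtained are the two integrals in the
assertion (\<open>low_frequency_sum\<close>, \<open>high_frequency_sum\<close>).

The Bernstein inequality is proved by complex analysis. For a functional \<open>l\<close>, the function
\<open>g z = l (U (z / r) y)\<close> extends to an entire function of exponential type, and by Cauchy's
inequality it suffices to bound \<open>g\<close> on the unit circle by a constant times \<open>\<parallel>y\<parallel>\<close>, uniformly in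
\<open>r\<close>. At a real point \<open>t\<close>, \<open>g\<close> is dominated by \<open>\<parallel>U (t / r)\<parallel> \<parallel>y\<parallel>\<close>. Averaging the subadditive function
\<open>ln \<parallel>U t\<parallel>\<close> yields from the integrability hypothesis numbers \<open>a\<^sub>j\<close> with
\<open>ln \<parallel>U t\<parallel> \<le> a\<^sub>j\<close> for \<open>\<bar>t\<bar> \<le> 2\<^sup>j\<close> and \<open>\<Sum>j. a\<^sub>j / 2\<^sup>j < \<infinity>\<close> (\<open>subadditive_dyadic_growth\<close>). Exactly
this summability allows a function \<open>Q\<close>, holomorphic in the upper half-plane and bounded near \<open>0\<close>,
whose real part is nonnegative there and dominates the growth on the real line
(\<open>majorant_exists\<close>). Then \<open>g \<cdot> exp (- Q)\<close> is bounded on the real line, and a Phragmen-Lindelof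
argument bounds it, up to a factor \<open>exp (const \<cdot> Im z)\<close>, in the half-plane
(\<open>halfplane_bound\<close>, \<open>entire_bound_near_zero\<close>).
\<close>

section \<open>Norming functionals\<close>

text \<open>
The instance of the Hahn-Banach theorem needed here. Partial functionals are represented by their
graphs, linear subspaces of the product with the real line; the domination \<open>r \<le> norm x\<close> on
a subspace already forces it to be single-valued, so Zorn's lemma can be applied to plain sets.
\<close>

lemma norming_functional:
  fixes v :: "'a::real_normed_vector"
  obtains \<phi> :: "'a \<Rightarrow> real" where "linear \<phi>" "\<And>x. \<bar>\<phi> x\<bar> \<le> norm x" "\<phi> v = norm v"
proof -
  define C where "C = {G::('a \<times> real) set. subspace G \<and> (\<forall>x r. (x, r) \<in> G \<longrightarrow> r \<le> norm x) \<and> (v, norm v) \<in> G}"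
  have "span {(v, norm v)} \<in> C"
  proof -
    have "a * norm v \<le> norm (a *\<^sub>R v)" for a by (simp add: mult_right_mono)
    thus ?thesis unfolding C_def
      by (auto simp: subspace_span span_base) (auto simp: span_singleton)
  qed
  hence ne: "C \<noteq> {}" by blast
  have "\<Union>\<C> \<in> C" if chn: "\<C> \<noteq> {}" "subset.chain C \<C>" for \<C>
  proof -
    have sub: "\<And>G. G \<in> \<C> \<Longrightarrow> G \<in> C"
      and tot: "\<And>G H. G \<in> \<C> \<Longrightarrow> H \<in> \<C> \<Longrightarrow> G \<subseteq> H \<or> H \<subseteq> G"
      using chn(2) by (auto simp: subset_chain_def)
    have ss: "\<And>G. G \<in> \<C> \<Longrightarrow> subspace G" using sub by (auto simp: C_def)
    have "subspace (\<Union>\<C>)"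
      unfolding subspace_def
    proof (intro conjI ballI allI)
      show "0 \<in> \<Union>\<C>" using chn(1) ss subspace_0 by blast
      show "x + y \<in> \<Union>\<C>" if xy: "x \<in> \<Union>\<C>" "y \<in> \<Union>\<C>" for x y
        proof -
        obtain G H where GH: "G \<in> \<C>" "H \<in> \<C>" "x \<in> G" "y \<in> H" using xy by blast
        then obtain K where "K \<in> \<C>" "x \<in> K" "y \<in> K" using tot[OF GH(1,2)] by blast
        thus ?thesis using subspace_add[OF ss] by blast
      qed
      show "c *\<^sub>R x \<in> \<Union>\<C>" if "x \<in> \<Union>\<C>" for c x
        using that subspace_scale[OF ss] by blast
    qed
    thus ?thesis using sub chn(1) unfolding C_def by blast
  qed
  from subset_Zorn_nonempty[OF ne this] obtain M where
    "M \<in> C" and Mmax: "\<And>X. X \<in> C \<Longrightarrow> M \<subseteq> X \<Longrightarrow> X = M" by blast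
  hence M: "subspace M" "\<And>x r. (x, r) \<in> M \<Longrightarrow> r \<le> norm x" "(v, norm v) \<in> M" by (auto simp: C_def)
  have total: "\<exists>c. (w, c) \<in> M" for w
  proof -
    have sep: "r - norm (x - w) \<le> norm (y + w) - s" if "(x, r) \<in> M" "(y, s) \<in> M" for x r y s
    proof -
      have "r + s \<le> norm (x + y)" using M(2) subspace_add[OF M(1) that] by simp
      also have "\<dots> \<le> norm (x - w) + norm (y + w)"
        using norm_triangle_ineq[of "x - w" "y + w"] by (simp add: algebra_simps)
      finally show ?thesis by simp
    qed
    \<comment> \<open>Any value between the lower bounds in \<open>L\<close> and the upper bounds in \<open>sep\<close> is admissible at \<open>w\<close>.\<close>
    define L where "L = (\<lambda>(x, r). r - norm (x - w)) ` M"
    have L: "L \<noteq> {}" "bdd_above L"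
    proof -
      show "L \<noteq> {}" using M(3) by (auto simp: L_def)
      show "bdd_above L" unfolding L_def
        by (rule bdd_aboveI[of _ "norm (v + w) - norm v"]) (use sep[OF _ M(3)] in auto)
    qed
    define c where "c = Sup L"
    have lo: "r - norm (x - w) \<le> c" if "(x, r) \<in> M" for x r
      unfolding c_def using that L(2) by (intro cSup_upper) (use L(2) in \<open>force simp: L_def\<close>)+
    have hi: "c \<le> norm (y + w) - s" if "(y, s) \<in> M" for y s
      unfolding c_def using that sep L(1) by (intro cSup_least) (auto simp: L_def)
    define M' where "M' = {g + h | g h. g \<in> M \<and> h \<in> span {(w, c)}}"
    have "subspace M'" unfolding M'_def by (intro subspace_sums M subspace_span)
    moreover have MM': "M \<subseteq> M'"
    proof
      fix g assume "g \<in> M"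
      hence "g + 0 \<in> M'" unfolding M'_def using span_zero[of "{(w, c)}"] by blast
      thus "g \<in> M'" by simp
    qed
    moreover have "r \<le> norm x" if "(x, r) \<in> M'" for x r
    proof -
      from that obtain y s a where ys: "(y, s) \<in> M" and x: "x = y + a *\<^sub>R w" and r: "r = s + a * c"
        unfolding M'_def span_singleton by auto
      consider "a = 0" | "a > 0" | "a < 0" by linarith
      thus ?thesis
      proof cases
        case 1 thus ?thesis using M(2) ys x r by simp
      next
        case 2
        have "c \<le> norm ((1/a) *\<^sub>R y + w) - s / a"
          using subspace_scale[OF M(1) ys, of "1/a"] hi by auto
        hence "a * c \<le> a * (norm ((1/a) *\<^sub>R y + w) - s / a)" using 2 by (intro mult_left_mono) auto
        also have "\<dots> = norm (a *\<^sub>R ((1/a) *\<^sub>R y + w)) - s" using 2 unfolding norm_scaleR by (simp add: right_diff_distrib)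
        also have "a *\<^sub>R ((1/a) *\<^sub>R y + w) = x" using 2 x by (simp add: algebra_simps)
        finally show ?thesis using r by simp
      next
        case 3
        have "s / (-a) - norm ((1/(-a)) *\<^sub>R y - w) \<le> c"
          using subspace_scale[OF M(1) ys, of "1/(-a)"] lo by auto
        hence "(-a) * (s / (-a) - norm ((1/(-a)) *\<^sub>R y - w)) \<le> (-a) * c" using 3 by (intro mult_left_mono) auto
        also have "(-a) * (s / (-a) - norm ((1/(-a)) *\<^sub>R y - w)) = s - norm ((-a) *\<^sub>R ((1/(-a)) *\<^sub>R y - w))"
          using 3 unfolding norm_scaleR by (simp add: right_diff_distrib)
        also have "(-a) *\<^sub>R ((1/(-a)) *\<^sub>R y - w) = x" using 3 x by (simp add: algebra_simps)
        finally show ?thesis using r by simp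
      qed
    qed
    ultimately have "M' \<in> C" using M(3) by (auto simp: C_def)
    hence "M' = M" using Mmax MM' by blast
    moreover have "(w, c) \<in> M'"
    proof -
      have "0 + (w, c) \<in> M'" unfolding M'_def using subspace_0[OF M(1)] span_base[of "(w, c)" "{(w, c)}"] by blast
      thus ?thesis by simp
    qed
    ultimately show ?thesis by blast
  qed
  have uniq: "r = s" if "(x, r) \<in> M" "(x, s) \<in> M" for x r s
    using M(2)[of 0 "r - s"] M(2)[of 0 "s - r"] subspace_diff[OF M(1) that] subspace_diff[OF M(1) that(2) that(1)] by simp
  define \<phi> where "\<phi> x = (THE r. (x, r) \<in> M)" for x
  have \<phi>: "(x, \<phi> x) \<in> M" for x
    unfolding \<phi>_def using total uniq by (metis theI)
  have lin: "linear \<phi>"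
  proof (rule linearI)
    show "\<phi> (x + y) = \<phi> x + \<phi> y" for x y
      using uniq[OF \<phi>] subspace_add[OF M(1) \<phi>[of x] \<phi>[of y]] by simp
    show "\<phi> (c *\<^sub>R x) = c *\<^sub>R \<phi> x" for c x
      using uniq[OF \<phi>] subspace_scale[OF M(1) \<phi>[of x], of c] by simp
  qed
  moreover have "\<bar>\<phi> x\<bar> \<le> norm x" for x
    using M(2)[OF \<phi>[of x]] M(2)[OF \<phi>[of "-x"]] linear_neg[OF lin, of x] by simp
  moreover have "\<phi> v = norm v" using uniq[OF \<phi> M(3)] .
  ultimately show ?thesis by (rule that)
qed

section \<open>A Phragmen-Lindelof principle for the half-plane\<close>

text \<open>
The common core of all Phragmen-Lindelof arguments: damping factors \<open>G e\<close> that tend to \<open>1\<close> as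
\<open>e\<close> tends to \<open>0\<close> reduce an unbounded region to its intersection with a disc.
\<close>

lemma maximum_modulus_unbounded:
  fixes F :: "complex \<Rightarrow> complex" and G :: "real \<Rightarrow> complex \<Rightarrow> complex"
  assumes T: "closed T" and V: "open V" "T \<subseteq> V"
    and F: "F holomorphic_on V" and FM: "\<And>z. z \<in> frontier T \<Longrightarrow> norm (F z) \<le> M" and M: "M \<ge> 0"
    and G: "\<And>e. 0 < e \<Longrightarrow> e < 1 \<Longrightarrow> G e holomorphic_on V"
      "\<And>e z. 0 < e \<Longrightarrow> e < 1 \<Longrightarrow> z \<in> T \<Longrightarrow> norm (G e z) \<le> 1"
    and FG: "\<And>e. 0 < e \<Longrightarrow> e < 1 \<Longrightarrow> \<exists>R. \<forall>z\<in>T. norm z \<ge> R \<longrightarrow> norm (F z * G e z) \<le> M"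
    and lim: "\<And>z. z \<in> T \<Longrightarrow> ((\<lambda>e. G e z) \<longlongrightarrow> 1) (at_right 0)"
    and z: "z \<in> T"
  shows "norm (F z) \<le> M"
proof -
  have *: "norm (F z * G e z) \<le> M" if e: "0 < e" "e < 1" for e
  proof -
    obtain R where R: "\<And>z. z \<in> T \<Longrightarrow> norm z \<ge> R \<Longrightarrow> norm (F z * G e z) \<le> M" using FG[OF e] by blast
    show ?thesis
    proof (cases "norm z \<ge> R")
      case True thus ?thesis using R z by blast
    next
      case False
      let ?S = "T \<inter> cball 0 R"
      have hol: "(\<lambda>z. F z * G e z) holomorphic_on V" using F G(1)[OF e] by (intro holomorphic_intros)
      have clo: "closed ?S" using T by blast
      have "norm (F w * G e w) \<le> M" if w: "w \<in> frontier ?S" for w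
      proof -
        have wS: "w \<in> ?S" using clo w frontier_subset_closed by blast
        show ?thesis
        proof (cases "norm w \<ge> R")
          case True thus ?thesis using R wS by blast
        next
          case False
          have "w \<in> frontier T"
            using w wS False by (auto simp: frontier_def closure_closed[OF T] clo interior_Int[of T "cball 0 R"])
          hence "norm (F w) * norm (G e w) \<le> M * 1"
            using FM G(2)[OF e] wS M by (intro mult_mono) auto
          thus ?thesis by (simp add: norm_mult)
        qed
      qed
      moreover have "bounded ?S" by blast
      moreover have "(\<lambda>z. F z * G e z) holomorphic_on interior ?S"
        using hol by (rule holomorphic_on_subset) (use V interior_subset in blast)
      moreover have "continuous_on (closure ?S) (\<lambda>z. F z * G e z)"
        using holomorphic_on_imp_continuous_on[OF hol] by (rule continuous_on_subset) (use V clo in auto)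
      ultimately show ?thesis
        using maximum_modulus_frontier[of "\<lambda>z. F z * G e z" ?S M z] z False by auto
    qed
  qed
  have "((\<lambda>e. norm (F z * G e z)) \<longlongrightarrow> norm (F z * 1)) (at_right 0)"
    using lim[OF z] by (intro tendsto_intros)
  moreover have "eventually (\<lambda>e. norm (F z * G e z) \<le> M) (at_right 0)"
    using * by (auto simp: eventually_at_right_field intro!: exI[of _ 1])
  ultimately show ?thesis
    using tendsto_upperbound by fastforce
qed

text \<open>
Both sectors between the real axis and the lines \<open>\<bar>Re z\<bar> = 2 Im z\<close> lie within the angle where
\<open>Re (z\<^sup>2)\<close> is comparable with \<open>\<bar>z\<bar>\<^sup>2\<close>. Hence the entire function \<open>exp (- e z\<^sup>2)\<close> beats
any exponential growth there, and no fractional powers are required.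
\<close>

lemma sector_bound:
  assumes V: "open V" "{z. Im z \<ge> 0} \<subseteq> V" and F: "F holomorphic_on V"
    and gr: "\<And>z. Im z \<ge> 0 \<Longrightarrow> norm (F z) \<le> c * exp (b * norm z)"
    and M0: "M > 0" and M: "\<And>x. norm (F (of_real x)) \<le> M"
    and diag: "\<And>z. Im z \<ge> 0 \<Longrightarrow> \<bar>Re z\<bar> = 2 * Im z \<Longrightarrow> norm (F z) \<le> M"
    and z: "Im z \<ge> 0" "2 * Im z \<le> \<bar>Re z\<bar>"
  shows "norm (F z) \<le> M"
proof -
  define T where "T = {z. Im z \<ge> 0 \<and> 2 * Im z \<le> \<bar>Re z\<bar>}"
  have c0: "c \<ge> 0" using order_trans[OF norm_ge_zero gr[of 0]] by simp
  have "closed T" unfolding T_def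
    by (intro closed_Collect_conj closed_Collect_le continuous_intros)
  have op: "open {z. Im z > 0 \<and> 2 * Im z < \<bar>Re z\<bar>}"
    by (intro open_Collect_conj open_Collect_less continuous_intros)
  have fr: "norm (F w) \<le> M" if "w \<in> frontier T" for w
  proof -
    have wT: "w \<in> T" using that \<open>closed T\<close> frontier_subset_closed by blast
    have "w \<notin> interior T" using that by (simp add: frontier_def)
    moreover have "{z. Im z > 0 \<and> 2 * Im z < \<bar>Re z\<bar>} \<subseteq> interior T"
      by (intro interior_maximal op) (auto simp: T_def)
    ultimately have "\<not> (Im w > 0 \<and> 2 * Im w < \<bar>Re w\<bar>)" by blast
    moreover have "Im w \<ge> 0" "2 * Im w \<le> \<bar>Re w\<bar>" using wT by (auto simp: T_def)
    ultimately have "Im w = 0 \<or> \<bar>Re w\<bar> = 2 * Im w" by linarith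
    thus ?thesis
    proof
      assume "Im w = 0" hence "w = of_real (Re w)" by (simp add: complex_eq_iff)
      thus ?thesis using M by metis
    qed (use diag \<open>Im w \<ge> 0\<close> in auto)
  qed
  have re2: "Re (w^2) \<ge> (3/5) * (norm w)^2" if "w \<in> T" for w
  proof -
    have "(2 * Im w)^2 \<le> \<bar>Re w\<bar>^2" using that by (intro power_mono) (auto simp: T_def)
    thus ?thesis by (simp add: cmod_power2 power2_eq_square[of w]) (simp add: power2_eq_square)
  qed
  have ex: "norm (exp (- (of_real e * w^2))) \<le> exp (- (e * (3/5) * (norm w)^2))" if "w \<in> T" "e > 0" for w and e :: real
    using mult_left_mono[OF re2[OF that(1)], of e] that by simp
  show ?thesis
  proof (rule maximum_modulus_unbounded[where T=T and V=V and F=F and M=M and G="\<lambda>e z. exp (- (of_real e * z^2))"])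
    show "closed T" "open V" "F holomorphic_on V" by fact+
    show "M \<ge> 0" using M0 by simp
    show "T \<subseteq> V" using V by (auto simp: T_def)
    show "z \<in> T" using z by (simp add: T_def)
    show "norm (F w) \<le> M" if "w \<in> frontier T" for w using fr that .
    show "(\<lambda>z. exp (- (of_real e * z^2))) holomorphic_on V" for e :: real by (intro holomorphic_intros)
    show "norm (exp (- (of_real e * w^2))) \<le> 1" if "e > 0" "w \<in> T" for w and e :: real
      using ex[OF that(2,1)] that by (elim order_trans) auto
    show "((\<lambda>e. exp (- (of_real e * w\<^sup>2))) \<longlongrightarrow> 1) (at_right 0)" for w :: complex
      by (auto intro!: tendsto_eq_intros)
    show "\<exists>R. \<forall>w\<in>T. R \<le> norm w \<longrightarrow> norm (F w * exp (- (of_real e * w\<^sup>2))) \<le> M" if e: "e > 0" for e :: real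
    proof -
      have "((\<lambda>r. c * exp (b * r - e * (3/5) * r^2)) \<longlongrightarrow> 0) at_top"
        using e by real_asymp
      hence "eventually (\<lambda>r. c * exp (b * r - e * (3/5) * r^2) < M) at_top"
        by (rule order_tendstoD) (use M0 in auto)
      then obtain R where R: "\<And>r. r \<ge> R \<Longrightarrow> c * exp (b * r - e * (3/5) * r^2) < M"
        by (auto simp: eventually_at_top_linorder)
      show ?thesis
      proof (intro exI[of _ R] ballI impI)
        fix w assume w: "w \<in> T" "R \<le> norm w"
        have "norm (F w * exp (- (of_real e * w\<^sup>2))) \<le> c * exp (b * norm w) * exp (- (e * (3/5) * (norm w)^2))"
          unfolding norm_mult using w ex[OF w(1) e] gr[of w] c0 by (intro mult_mono) (auto simp: T_def)
        also have "\<dots> = c * exp (b * norm w - e * (3/5) * (norm w)^2)" by (simp add: exp_add[symmetric] mult.assoc)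
        also have "\<dots> \<le> M" using R[OF w(2)] by simp
        finally show "norm (F w * exp (- (of_real e * w\<^sup>2))) \<le> M" .
      qed
    qed
  qed
qed

text \<open>
The bound \<open>M'\<close> in the cone around the imaginary axis enters only qualitatively: with it the
sectors on either side show that \<open>F\<close> is bounded at all, and for a bounded function the weak damping
\<open>1 / (1 - \<i> e z)\<close> suffices to replace \<open>M'\<close> by the bound \<open>M\<close> on the real line.
\<close>

lemma halfplane_bound:
  assumes V: "open V" "{z. Im z \<ge> 0} \<subseteq> V" and F: "F holomorphic_on V"
    and gr: "\<And>z. Im z \<ge> 0 \<Longrightarrow> norm (F z) \<le> c * exp (b * norm z)"
    and M0: "M > 0" and M: "\<And>x. norm (F (of_real x)) \<le> M"
    and cone: "\<And>z. \<bar>Re z\<bar> \<le> 2 * Im z \<Longrightarrow> norm (F z) \<le> M'"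
    and z: "Im z \<ge> 0"
  shows "norm (F z) \<le> M"
proof -
  define L where "L = max M M'"
  have L: "norm (F z) \<le> L" if "Im z \<ge> 0" for z
  proof (cases "\<bar>Re z\<bar> \<le> 2 * Im z")
    case True thus ?thesis using cone[OF True] by (simp add: L_def)
  next
    case False
    show ?thesis
    proof (rule sector_bound[OF V F gr])
      show "norm (F (of_real x)) \<le> L" for x using M[of x] by (simp add: L_def)
      show "norm (F z) \<le> L" if "\<bar>Re z\<bar> = 2 * Im z" for z using cone[of z] that by (simp add: L_def)
    qed (use False that M0 in \<open>auto simp: L_def\<close>)
  qed
  have L0: "L > 0" using M0 by (simp add: L_def)
  define T where "T = {z. Im z \<ge> 0}"
  have clo: "closed T" unfolding T_def by (intro closed_Collect_le continuous_intros)
  let ?V = "V \<inter> {z. Im z > -1}"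
  have re: "Re (1 - \<i> * of_real e * w) = 1 + e * Im w" for e w by simp
  have pos: "Re (1 - \<i> * of_real e * w) > 0" if "0 < e" "e < 1" "Im w > -1" for e w
  proof -
    have "e * (-1) < e * Im w" using that by (intro mult_strict_left_mono) auto
    thus ?thesis using that unfolding re by linarith
  qed
  have ge1: "norm (1 - \<i> * of_real e * w) \<ge> 1" if "0 < e" "w \<in> T" for e w
  proof -
    have "0 \<le> e * Im w" using that by (simp add: T_def)
    thus ?thesis using abs_Re_le_cmod[of "1 - \<i> * of_real e * w"] unfolding re by linarith
  qed
  have gez: "norm (1 - \<i> * of_real e * w) \<ge> e * norm w" if "0 < e" "w \<in> T" for e w
  proof -
    have "(e * norm w)^2 \<le> (norm (1 - \<i> * of_real e * w))^2"
      using mult_nonneg_nonneg[of e "Im w"] that unfolding power_mult_distrib cmod_power2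
      by (simp add: T_def algebra_simps power2_eq_square)
    thus ?thesis by (rule power2_le_imp_le) auto
  qed
  show ?thesis
  proof (rule maximum_modulus_unbounded[where T=T and V="?V" and F=F and M=M and G="\<lambda>e z. 1 / (1 - \<i> * of_real e * z)"])
    show "closed T" by fact
    show "open ?V" by (intro open_Int V open_Collect_less continuous_intros)
    show "T \<subseteq> ?V" using V by (auto simp: T_def)
    show "F holomorphic_on ?V" using F by (rule holomorphic_on_subset) auto
    show "M \<ge> 0" using M0 by simp
    show "z \<in> T" using z by (simp add: T_def)
    show "norm (F w) \<le> M" if w: "w \<in> frontier T" for w
    proof -
      have "{z. Im z > 0} \<subseteq> interior T"
        by (intro interior_maximal open_Collect_less continuous_intros) (auto simp: T_def)
      moreover have "w \<in> T" "w \<notin> interior T" using w clo by (auto simp: frontier_def)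
      ultimately have "w \<notin> {z. Im z > 0}" "w \<in> T" by blast+
      hence "\<not> Im w > 0" "Im w \<ge> 0" unfolding T_def by blast+
      hence "w = of_real (Re w)" by (simp add: complex_eq_iff)
      thus ?thesis using M by metis
    qed
    show "(\<lambda>z. 1 / (1 - \<i> * of_real e * z)) holomorphic_on ?V" if e: "0 < e" "e < 1" for e :: real
    proof -
      have "1 - \<i> * of_real e * w \<noteq> 0" if "w \<in> ?V" for w using pos[OF e, of w] that by force
      thus ?thesis by (intro holomorphic_intros)
    qed
    show "norm (1 / (1 - \<i> * of_real e * w)) \<le> 1" if "0 < e" "w \<in> T" for w and e :: real
      using ge1[OF that] by (simp add: norm_divide divide_simps)
    show "((\<lambda>e. 1 / (1 - \<i> * of_real e * w)) \<longlongrightarrow> 1) (at_right 0)" for w :: complex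
      by (auto intro!: tendsto_eq_intros)
    show "\<exists>R. \<forall>w\<in>T. R \<le> norm w \<longrightarrow> norm (F w * (1 / (1 - \<i> * of_real e * w))) \<le> M" if e: "e > 0" for e :: real
    proof (intro exI[of _ "L / (e * M)"] ballI impI)
      fix w assume w: "w \<in> T" "L / (e * M) \<le> norm w"
      have "norm (F w) \<le> L" using L w by (simp add: T_def)
      also have "L \<le> M * (e * norm w)" using w(2) e M0 by (simp add: field_simps)
      also have "\<dots> \<le> M * norm (1 - \<i> * of_real e * w)" using gez[OF e w(1)] M0 by simp
      finally show "norm (F w * (1 / (1 - \<i> * of_real e * w))) \<le> M"
        using ge1[OF e w(1)] M0 by (simp add: norm_mult norm_divide divide_simps)
    qed
  qed
qed

section \<open>Functions dominated by a log-integrable weight on the real line\<close>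

text \<open>
The function \<open>z / (z + \<i> R)\<close> is a smoothed harmonic measure of \<open>{t. \<bar>t\<bar> \<ge> R}\<close>: its real part is
nonnegative in the upper half-plane and at least \<open>1/2\<close> on the real points with \<open>\<bar>t\<bar> \<ge> R\<close>,
while its modulus is only about \<open>\<bar>z\<bar> / R\<close> near \<open>0\<close>. So \<open>Q\<close>, the superposition of these functions
over \<open>R = 2\<^sup>j\<close> with weights \<open>c j\<close>, converges exactly under the stated summability. The strip below
the real axis serves to have \<open>Q\<close> holomorphic on a neighbourhood of the closed half-plane.
\<close>

lemma majorant_exists:
  fixes c :: "nat \<Rightarrow> real"
  assumes c: "\<And>j. c j \<ge> 0" "summable (\<lambda>j. c j / 2 ^ j)"
  obtains Q :: "complex \<Rightarrow> complex" and S where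
    "Q holomorphic_on {z. Im z > -1/2}"
    "\<And>z. Im z \<ge> 0 \<Longrightarrow> Re (Q z) \<ge> 0"
    "\<And>z. Im z \<ge> 0 \<Longrightarrow> norm (Q z) \<le> S * norm z"
    "\<And>t j. \<bar>t\<bar> \<ge> 2 ^ j \<Longrightarrow> Re (Q (of_real t)) \<ge> c j / 2"
proof -
  let ?V = "{z. Im z > -1/2}"
  define \<phi> where "\<phi> j z = of_real (c j) * (z / (z + \<i> * 2 ^ j))" for j and z :: complex
  define Q where "Q z = (\<Sum>j. \<phi> j z)" for z
  define S where "S = (\<Sum>j. 2 * (c j / 2 ^ j))"
  have im: "Im (z + \<i> * 2 ^ j) = Im z + 2 ^ j" for z j
    by (metis Im_i_times Re_complex_of_real of_real_numeral of_real_power plus_complex.sel(2))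
  have re: "Re (z + \<i> * 2 ^ j) = Re z" for z j
    by (metis Re_i_times Im_complex_of_real of_real_numeral of_real_power plus_complex.sel(1) add.right_neutral neg_equal_0_iff_equal)
  have lb: "norm (z + \<i> * 2 ^ j) \<ge> 2 ^ j / 2" if "z \<in> ?V" for z j
  proof -
    have "(2::real) ^ j \<ge> 1" by simp
    thus ?thesis using abs_Im_le_cmod[of "z + \<i> * 2 ^ j"] that unfolding im mem_Collect_eq by linarith
  qed
  have nz: "z + \<i> * 2 ^ j \<noteq> 0" if "z \<in> ?V" for z j
  proof -
    have "norm (z + \<i> * 2 ^ j) > 0" by (rule less_le_trans[OF _ lb[OF that]]) simp
    thus ?thesis by force
  qed
  have bound: "norm (\<phi> j z) \<le> norm z * (2 * (c j / 2 ^ j))" if "z \<in> ?V" for j z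
  proof -
    have "norm (\<phi> j z) = c j * (norm z / norm (z + \<i> * 2 ^ j))" using c(1) by (simp add: \<phi>_def norm_mult norm_divide)
    also have "\<dots> \<le> c j * (norm z / (2 ^ j / 2))"
      using lb[OF that, of j] c(1)[of j] nz[OF that, of j] by (intro mult_left_mono divide_left_mono mult_pos_pos) auto
    finally show ?thesis by (simp add: field_simps)
  qed
  have sm2: "summable (\<lambda>j. 2 * (c j / 2 ^ j))" using c(2) by (rule summable_mult)
  have sm: "summable (\<lambda>j. norm (\<phi> j z))" if "z \<in> ?V" for z
    by (rule summable_comparison_test'[OF summable_mult[OF sm2, of "norm z"], of 0]) (use bound[OF that] in auto)
  show ?thesis
  proof (rule that[of Q S])
    show "Q holomorphic_on ?V"
    proof (rule holomorphic_uniform_sequence[where f="\<lambda>n z. \<Sum>j<n. \<phi> j z"])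
      show op: "open ?V" by (intro open_Collect_less continuous_intros)
      show "(\<lambda>z. \<Sum>j<n. \<phi> j z) holomorphic_on ?V" for n
        unfolding \<phi>_def using nz by (intro holomorphic_intros) auto
      fix x assume "x \<in> ?V"
      then obtain d where d: "d > 0" "cball x d \<subseteq> ?V" using op open_contains_cball by blast
      have "uniform_limit (cball x d) (\<lambda>n z. \<Sum>j<n. \<phi> j z) (\<lambda>z. \<Sum>j. \<phi> j z) sequentially"
      proof (rule Weierstrass_m_test)
        show "norm (\<phi> j z) \<le> (norm x + d) * (2 * (c j / 2 ^ j))" if "z \<in> cball x d" for j z
        proof -
          have "norm z \<le> norm x + d" using that norm_triangle_ineq2[of z x] by (simp add: dist_norm norm_minus_commute)
          hence "norm z * (2 * (c j / 2 ^ j)) \<le> (norm x + d) * (2 * (c j / 2 ^ j))" using c by (intro mult_right_mono) auto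
          thus ?thesis using bound[of z j] that d by force
        qed
        show "summable (\<lambda>j. (norm x + d) * (2 * (c j / 2 ^ j)))" using sm2 by (rule summable_mult)
      qed
      thus "\<exists>d>0. cball x d \<subseteq> ?V \<and> uniform_limit (cball x d) (\<lambda>n z. \<Sum>j<n. \<phi> j z) Q sequentially"
        using d unfolding Q_def by blast
    qed
    have re_phi: "Re (\<phi> j z) = c j * (((Re z)\<^sup>2 + Im z * (Im z + 2 ^ j)) / ((Re z)\<^sup>2 + (Im z + 2 ^ j)\<^sup>2))" for j z
    proof -
      have "Re (\<phi> j z) = c j * Re (z / (z + \<i> * 2 ^ j))" 
        unfolding \<phi>_def scaleR_conv_of_real[symmetric] by (rule scaleR_complex.sel(1))
      thus ?thesis unfolding Re_divide re im by (simp add: power2_eq_square)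
    qed
    have re_nonneg: "Re (\<phi> j z) \<ge> 0" if "Im z \<ge> 0" for j z
      unfolding re_phi using that c(1) by (intro mult_nonneg_nonneg divide_nonneg_nonneg add_nonneg_nonneg) auto
    have ReQ: "Re (Q z) = (\<Sum>j. Re (\<phi> j z))" "summable (\<lambda>j. Re (\<phi> j z))" if "z \<in> ?V" for z
      using summable_norm_cancel[OF sm[OF that]] by (auto simp: Q_def intro: Re_suminf summable_Re)
    show "Re (Q z) \<ge> 0" if "Im z \<ge> 0" for z
      using ReQ[of z] re_nonneg[OF that] that by (auto intro: suminf_nonneg)
    show "norm (Q z) \<le> S * norm z" if "Im z \<ge> 0" for z
    proof -
      have zV: "z \<in> ?V" using that by simp
      have "norm (Q z) \<le> (\<Sum>j. norm (\<phi> j z))" unfolding Q_def using sm[OF zV] by (rule summable_norm)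
      also have "\<dots> \<le> (\<Sum>j. norm z * (2 * (c j / 2 ^ j)))"
        using bound[OF zV] sm[OF zV] summable_mult[OF sm2] by (rule suminf_le)
      also have "\<dots> = norm z * S" unfolding S_def using sm2 by (rule suminf_mult)
      finally show ?thesis by (simp add: mult.commute)
    qed
    show "Re (Q (of_real t)) \<ge> c j / 2" if t: "\<bar>t\<bar> \<ge> 2 ^ j" for t j
    proof -
      have "(2 ^ j)\<^sup>2 \<le> \<bar>t\<bar>\<^sup>2" using t by (intro power_mono) auto
      hence "t\<^sup>2 / (t\<^sup>2 + (2 ^ j)\<^sup>2) \<ge> 1 / 2" by (simp add: divide_simps add_pos_pos add_nonneg_pos)
      from mult_left_mono[OF this c(1)[of j]] have "c j / 2 \<le> Re (\<phi> j (of_real t))"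
        unfolding re_phi by simp
      also have "\<dots> = (\<Sum>i\<in>{j}. Re (\<phi> i (of_real t)))" by simp
      also have "\<dots> \<le> (\<Sum>i. Re (\<phi> i (of_real t)))"
        by (intro sum_le_suminf ReQ re_nonneg) auto
      finally show ?thesis using ReQ(1)[of "of_real t"] by simp
    qed
  qed
qed

text \<open>
The multiplier \<open>exp (- Q z)\<close> removes the growth on the real line, and \<open>exp (6 \<i> z)\<close> the exponential
growth in the cone \<open>\<bar>Re z\<bar> \<le> 2 Im z\<close>, where \<open>2 \<bar>z\<bar> \<le> 6 Im z\<close>. What matters is that \<open>C\<close>
depends on the weight \<open>a\<close> alone, and neither on \<open>g\<close> nor on \<open>c\<close>.
\<close>

lemma entire_bound_near_zero:
  fixes a :: "nat \<Rightarrow> real"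
  assumes a: "\<And>j. a j \<ge> 0" "summable (\<lambda>j. a j / 2 ^ j)"
  obtains C where "C > 0"
    "\<And>g c M k. g holomorphic_on UNIV \<Longrightarrow> (\<And>z. norm (g z) \<le> c * exp (2 * norm z)) \<Longrightarrow> M > 0 \<Longrightarrow>
       (\<And>t j. \<bar>t\<bar> \<le> 2 ^ j \<Longrightarrow> norm (g (of_real t)) \<le> M * exp (a j)) \<Longrightarrow>
       norm ((deriv ^^ k) g 0) \<le> fact k * (C * M)"
proof -
  \<comment> \<open>The factor \<open>2\<close> compensates the \<open>1/2\<close> in the majorant; the shift is there because a point with
     \<open>2 ^ j \<le> \<bar>t\<bar> < 2 ^ Suc j\<close> has weight \<open>a (Suc j)\<close>.\<close>
  define c where "c j = 2 * a (Suc j)" for j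
  have "summable (\<lambda>j. 4 * (a (Suc j) / 2 ^ Suc j))"
    using a(2) by (intro summable_mult) (subst summable_Suc_iff)
  moreover have "4 * (a (Suc j) / 2 ^ Suc j) = c j / 2 ^ j" for j by (simp add: c_def)
  ultimately have c_sum: "summable (\<lambda>j. c j / 2 ^ j)" by simp
  have c_nonneg: "c j \<ge> 0" for j using a(1) by (simp add: c_def)
  obtain Q S where Qh: "Q holomorphic_on {z. Im z > -1/2}"
    and Qre: "\<And>z. Im z \<ge> 0 \<Longrightarrow> Re (Q z) \<ge> 0"
    and Qn: "\<And>z. Im z \<ge> 0 \<Longrightarrow> norm (Q z) \<le> S * norm z"
    and Qt: "\<And>t j. \<bar>t\<bar> \<ge> 2 ^ j \<Longrightarrow> Re (Q (of_real t)) \<ge> c j / 2"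
    using majorant_exists[OF c_nonneg c_sum] by blast
  have S0: "S \<ge> 0" using order_trans[OF norm_ge_zero Qn[of 1]] by simp
  define C where "C = exp (a 0 + S + 6)"
  have upper: "norm (g z) \<le> C * M"
    if g: "g holomorphic_on UNIV" "\<And>z. norm (g z) \<le> b * exp (2 * norm z)" and M: "M > 0"
      "\<And>t j. \<bar>t\<bar> \<le> 2 ^ j \<Longrightarrow> norm (g (of_real t)) \<le> M * exp (a j)" and z: "Im z \<ge> 0" "norm z \<le> 1"
    for g b M z
  proof -
    define F where "F z = g z * exp (\<i> * 6 * z - Q z)" for z
    have b0: "b \<ge> 0" using order_trans[OF norm_ge_zero g(2)[of 0]] by simp
    have nF: "norm (F z) = norm (g z) * exp (- 6 * Im z - Re (Q z))" for z
      unfolding F_def norm_mult norm_exp_eq_Re by simp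
    have "norm (F z) \<le> M * exp (a 0)"
    proof (rule halfplane_bound[where V="{z. Im z > -1/2}" and b=2 and c=b and M'=b and F=F])
      show "open {z. Im z > -1/2}" by (intro open_Collect_less continuous_intros)
      show "F holomorphic_on {z. Im z > -1/2}"
        unfolding F_def using g(1) Qh by (intro holomorphic_intros) (auto intro: holomorphic_on_subset)
      show "norm (F w) \<le> b * exp (2 * norm w)" if "Im w \<ge> 0" for w
      proof -
        have "norm (F w) \<le> norm (g w) * 1" unfolding nF using Qre[OF that] that by (intro mult_left_mono) auto
        thus ?thesis using g(2)[of w] by simp
      qed
      show "norm (F w) \<le> b" if "\<bar>Re w\<bar> \<le> 2 * Im w" for w
      proof -
        have im: "Im w \<ge> 0" using that by linarith
        have "norm w \<le> \<bar>Re w\<bar> + \<bar>Im w\<bar>" by (rule cmod_le)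
        hence n: "norm w \<le> 3 * Im w" using that by linarith
        have "norm (F w) \<le> b * exp (2 * norm w) * exp (- 6 * Im w - Re (Q w))"
          unfolding nF using g(2)[of w] by (intro mult_right_mono) auto
        also have "\<dots> = b * exp (2 * norm w - 6 * Im w - Re (Q w))" by (simp add: exp_add[symmetric] mult.assoc)
        also have "\<dots> \<le> b * 1" using n Qre[OF im] b0 by (intro mult_left_mono) auto
        finally show ?thesis by simp
      qed
      show "norm (F (of_real t)) \<le> M * exp (a 0)" for t
      proof (cases "\<bar>t\<bar> \<le> 1")
        case True
        have "norm (F (of_real t)) \<le> norm (g (of_real t)) * 1" unfolding nF using Qre[of "of_real t"] by (intro mult_left_mono) auto
        thus ?thesis using M(2)[of t 0] True by simp
      next
        case False
        obtain n where n: "\<bar>t\<bar> < 2 ^ n" using real_arch_pow[of 2 "\<bar>t\<bar>"] by auto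
        define m where "m = (LEAST n. \<bar>t\<bar> < 2 ^ n)"
        have m: "\<bar>t\<bar> < 2 ^ m" unfolding m_def using n by (rule LeastI)
        obtain j where j: "m = Suc j" using m False by (cases m) auto
        have "\<not> \<bar>t\<bar> < 2 ^ j" using j not_less_Least[of j "\<lambda>n. \<bar>t\<bar> < 2 ^ n"] unfolding m_def by simp
        hence "Re (Q (of_real t)) \<ge> a m" using Qt[of j t] by (simp add: c_def j)
        have "norm (F (of_real t)) \<le> M * exp (a m) * exp (- a m)" unfolding nF
          using M(2)[of t m] m \<open>Re (Q (of_real t)) \<ge> a m\<close> M(1) by (intro mult_mono) auto
        also have "\<dots> = M * 1" by (simp add: exp_minus)
        also have "\<dots> \<le> M * exp (a 0)" using M(1) a(1)[of 0] by (intro mult_left_mono) auto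
        finally show ?thesis .
      qed
    qed (use z M in auto)
    hence "norm (g z) * exp (- 6 * Im z - Re (Q z)) * exp (6 * Im z + Re (Q z)) \<le> M * exp (a 0) * exp (S + 6)"
      unfolding nF
    proof (rule mult_mono)
      have "Re (Q z) \<le> S" using complex_Re_le_cmod[of "Q z"] Qn[OF z(1)] mult_left_mono[OF z(2) S0] by linarith
      moreover have "Im z \<le> 1" using abs_Im_le_cmod[of z] z by linarith
      ultimately show "exp (6 * Im z + Re (Q z)) \<le> exp (S + 6)" by simp
    qed (use M in auto)
    thus ?thesis by (simp add: C_def mult.assoc exp_add[symmetric] mult_ac add_ac)
  qed
  show ?thesis
  proof (rule that[of C])
    show "C > 0" by (simp add: C_def)
    fix g b M k
    assume g: "g holomorphic_on UNIV" "\<And>z. norm (g z) \<le> b * exp (2 * norm z)" and M: "M > (0::real)"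
      "\<And>t j. \<bar>t\<bar> \<le> 2 ^ j \<Longrightarrow> norm (g (of_real t)) \<le> M * exp (a j)"
    \<comment> \<open>The hypotheses are symmetric under \<open>z \<mapsto> - z\<close>, which exchanges the two half-planes.\<close>
    have "norm (g z) \<le> C * M" if z: "norm z = 1" for z
    proof (cases "Im z \<ge> 0")
      case True thus ?thesis using upper[OF g M] z by simp
    next
      case False
      have "norm ((\<lambda>z. g (-z)) (-z)) \<le> C * M"
      proof (rule upper[where g="\<lambda>z. g (- z)"])
        show "(\<lambda>z. g (- z)) holomorphic_on UNIV"
          using holomorphic_on_compose_gen[OF holomorphic_on_minus[OF holomorphic_on_ident] g(1)] by (simp add: o_def)
        show "norm (g (- w)) \<le> b * exp (2 * norm w)" for w using g(2)[of "-w"] by simp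
        show "norm (g (- of_real t)) \<le> M * exp (a j)" if "\<bar>t\<bar> \<le> 2 ^ j" for t j
          using M(2)[of "-t" j] that by simp
      qed (use False z M in auto)
      thus ?thesis by simp
    qed
    hence "norm ((deriv ^^ k) g 0) \<le> fact k * (C * M) / 1 ^ k"
      using g(1) by (intro Cauchy_inequality) (auto intro: holomorphic_on_subset holomorphic_on_imp_continuous_on continuous_on_subset)
    thus "norm ((deriv ^^ k) g 0) \<le> fact k * (C * M)" by simp
  qed
qed

text \<open>
The form in which the bound is applied to vector-valued functions: coefficients and values on the
real line are all that a functional of a group orbit provides.
\<close>

lemma power_series_coefficient_bound:
  fixes a :: "nat \<Rightarrow> real"
  assumes a: "\<And>j. a j \<ge> 0" "summable (\<lambda>j. a j / 2 ^ j)"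
  obtains C where "C > 0"
    "\<And>(u :: nat \<Rightarrow> complex) c M k. (\<And>k. norm (u k) \<le> c * 2 ^ k / fact k) \<Longrightarrow> M > 0 \<Longrightarrow>
       (\<And>t j. \<bar>t\<bar> \<le> 2 ^ j \<Longrightarrow> norm (\<Sum>k. u k * of_real t ^ k) \<le> M * exp (a j)) \<Longrightarrow> norm (u k) \<le> C * M"
proof -
  obtain C where C: "C > 0" "\<And>g c M k. g holomorphic_on UNIV \<Longrightarrow> (\<And>z. norm (g z) \<le> c * exp (2 * norm z)) \<Longrightarrow> M > 0 \<Longrightarrow>
       (\<And>t j. \<bar>t\<bar> \<le> 2 ^ j \<Longrightarrow> norm (g (of_real t)) \<le> M * exp (a j)) \<Longrightarrow>
       norm ((deriv ^^ k) g 0) \<le> fact k * (C * M)"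
    using entire_bound_near_zero[OF a] by blast
  show ?thesis
  proof (rule that[OF C(1)])
    fix u :: "nat \<Rightarrow> complex" and c M k
    assume u: "\<And>k. norm (u k) \<le> c * 2 ^ k / fact k" and M: "M > 0"
      "\<And>t j. \<bar>t\<bar> \<le> 2 ^ j \<Longrightarrow> norm (\<Sum>k. u k * of_real t ^ k) \<le> M * exp (a j)"
    define g where "g z = (\<Sum>k. u k * z ^ k)" for z
    have ex: "(\<lambda>k. c * ((2 * norm z) ^ k /\<^sub>R fact k)) sums (c * exp (2 * norm z))" for z :: complex
      by (intro sums_mult exp_converges)
    have le: "norm (u k * z ^ k) \<le> c * ((2 * norm z) ^ k /\<^sub>R fact k)" for k z
    proof -
      have "norm (u k * z ^ k) \<le> c * 2 ^ k / fact k * norm z ^ k"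
        unfolding norm_mult norm_power using u[of k] by (intro mult_right_mono) auto
      thus ?thesis by (simp add: power_mult_distrib field_simps)
    qed
    have sm: "summable (\<lambda>k. norm (u k * z ^ k))" for z
      by (rule summable_comparison_test'[OF sums_summable[OF ex[of z]], of 0]) (use le in auto)
    have gs: "(\<lambda>k. u k * z ^ k) sums g z" for z
      unfolding g_def using summable_norm_cancel[OF sm] by (rule summable_sums)
    have gb: "norm (g z) \<le> c * exp (2 * norm z)" for z
    proof -
      have "norm (g z) \<le> (\<Sum>k. norm (u k * z ^ k))" unfolding g_def using sm by (rule summable_norm)
      also have "\<dots> \<le> c * exp (2 * norm z)"
        using suminf_le[OF le sm sums_summable[OF ex]] sums_unique[OF ex[of z]] by simp
      finally show ?thesis .
    qed
    have hol: "g holomorphic_on UNIV"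
      unfolding holomorphic_on_def
    proof
      fix z :: complex
      have "g holomorphic_on ball 0 (norm z + 1)"
        by (rule power_series_holomorphic[where a=u]) (use gs in simp)
      hence "g field_differentiable at z"
        by (rule holomorphic_on_imp_differentiable_at) auto
      thus "g field_differentiable at z within UNIV" by simp
    qed
    have "g has_fps_expansion Abs_fps u"
      by (rule has_fps_expansionI) (use gs in simp)
    from fps_nth_fps_expansion[OF this, of k] have "(deriv ^^ k) g 0 = fact k * u k" by simp
    moreover have "norm ((deriv ^^ k) g 0) \<le> fact k * (C * M)"
      using C(2)[OF hol gb M(1)] M(2) unfolding g_def by blast
    ultimately show "norm (u k) \<le> C * M" by (simp add: norm_mult)
  qed
qed

section \<open>Growth of subadditive functions\<close>

text \<open>
By subadditivity \<open>p t \<le> p s + p (t - s)\<close>; averaging over \<open>\<bar>s\<bar> \<le> 2\<^sup>j\<close> bounds \<open>p t\<close> for \<open>\<bar>t\<bar> \<le> 2\<^sup>j\<close> by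
\<open>2\<^sup>-\<^sup>j\<close> times the integral of \<open>\<bar>p\<bar>\<close> over \<open>[- 2 \<cdot> 2\<^sup>j, 2 \<cdot> 2\<^sup>j]\<close>. In particular \<open>p\<close> is locally bounded,
and for the group this replaces the uniform boundedness principle. The sum of \<open>a j / 2 ^ j\<close> is then
an integral of \<open>\<bar>p s\<bar>\<close> against \<open>\<Sum>j. 4\<^sup>-\<^sup>j\<close> over the \<open>j\<close> with \<open>\<bar>s\<bar> \<le> 2 \<cdot> 2\<^sup>j\<close>, which is of order
\<open>1 / (1 + s\<^sup>2)\<close>.
\<close>

lemma subadditive_dyadic_growth:
  fixes p :: "real \<Rightarrow> real"
  assumes sub: "\<And>s t. p (s + t) \<le> p s + p t" and int: "integrable lborel (\<lambda>t. p t / (1 + t\<^sup>2))"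
  obtains a :: "nat \<Rightarrow> real" where "\<And>j. a j \<ge> 0" "summable (\<lambda>j. a j / 2 ^ j)" "\<And>t j. \<bar>t\<bar> \<le> 2 ^ j \<Longrightarrow> p t \<le> a j"
proof -
  define w where "w s = \<bar>p s\<bar> / (1 + s\<^sup>2)" for s
  have pos: "1 + s\<^sup>2 > 0" for s :: real by (simp add: add_pos_nonneg)
  have w: "integrable lborel w"
    using integrable_abs[OF int] pos by (simp add: w_def[abs_def] abs_divide)
  define h where "h j s = indicator {- (2 ^ Suc j)..2 ^ Suc j} s * \<bar>p s\<bar>" for j :: nat and s :: real
  have meas [measurable]: "p \<in> borel_measurable lborel"
  proof -
    have "(\<lambda>t. p t / (1 + t\<^sup>2) * (1 + t\<^sup>2)) \<in> borel_measurable lborel"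
      using borel_measurable_integrable[OF int] by measurable
    moreover have "p t / (1 + t\<^sup>2) * (1 + t\<^sup>2) = p t" for t using pos[of t] by simp
    ultimately show ?thesis by simp
  qed
  have h_nonneg: "h j s \<ge> 0" for j s by (simp add: h_def)
  have h: "integrable lborel (h j)" for j
  proof (rule Bochner_Integration.integrable_bound)
    show "integrable lborel (\<lambda>s. (1 + (2 ^ Suc j)\<^sup>2) * w s)" using w by simp
    show "h j \<in> borel_measurable lborel" unfolding h_def[abs_def] by measurable
    have "h j s \<le> (1 + (2 ^ Suc j)\<^sup>2) * w s" for s
    proof (cases "\<bar>s\<bar> \<le> 2 ^ Suc j")
      case True
      hence "\<bar>s\<bar>\<^sup>2 \<le> (2 ^ Suc j)\<^sup>2" by (intro power_mono) auto
      hence "(1 + s\<^sup>2) * w s \<le> (1 + (2 ^ Suc j)\<^sup>2) * w s" by (intro mult_right_mono) (auto simp: w_def)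
      moreover have "(1 + s\<^sup>2) * w s = \<bar>p s\<bar>" using pos[of s] by (simp add: w_def)
      moreover have "h j s \<le> \<bar>p s\<bar>" by (simp add: h_def indicator_def)
      ultimately show ?thesis by linarith
    next
      case False
      hence "s \<notin> {- (2 ^ Suc j)..2 ^ Suc j}" by auto
      hence "h j s = 0" by (simp add: h_def del: atLeastAtMost_iff)
      thus ?thesis by (simp add: w_def)
    qed
    thus "AE s in lborel. norm (h j s) \<le> norm ((1 + (2 ^ Suc j)\<^sup>2) * w s)"
      using h_nonneg by (auto intro!: AE_I2 intro: order_trans[OF _ abs_ge_self])
  qed
  define a where "a j = (LINT s|lborel. h j s) / 2 ^ j" for j
  show ?thesis
  proof (rule that[of a])
    show a0: "a j \<ge> 0" for j using h_nonneg by (simp add: a_def)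
    show "p t \<le> a j" if t: "\<bar>t\<bar> \<le> 2 ^ j" for t j
    proof -
      have hr: "integrable lborel (\<lambda>s. h j (t + (-1) * s))"
        using h by (intro lborel_integrable_real_affine) auto
      have "(LINT s|lborel. h j s) = (LINT s|lborel. h j (t + (-1) * s))"
        using lborel_integral_real_affine[of "-1" "h j" t] by simp
      have "2 * 2 ^ j * p t = (LINT s|lborel. indicator {- (2 ^ j)..2 ^ j :: real} s * p t)" by simp
      also have "\<dots> \<le> (LINT s|lborel. h j s + h j (t + (-1) * s))"
      proof (rule integral_mono)
        show "integrable lborel (\<lambda>s. indicator {- (2 ^ j)..2 ^ j :: real} s * p t)" by simp
        show "integrable lborel (\<lambda>s. h j s + h j (t + (-1) * s))" using h hr by simp
        show "indicator {- (2 ^ j)..2 ^ j :: real} s * p t \<le> h j s + h j (t + (-1) * s)" for s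
        proof (cases "s \<in> {- (2 ^ j)..2 ^ j :: real}")
          case True
          have "s \<in> {- (2 ^ Suc j)..2 ^ Suc j}" "t + (-1) * s \<in> {- (2 ^ Suc j)..2 ^ Suc j}"
            using True t by (auto simp: abs_le_iff)
          hence "h j s = \<bar>p s\<bar>" "h j (t + (-1) * s) = \<bar>p (t + (-1) * s)\<bar>"
            by (simp_all add: h_def del: atLeastAtMost_iff)
          thus ?thesis using sub[of s "t + (-1) * s"] True by simp
        next
          case False
          thus ?thesis using h_nonneg[of j s] h_nonneg[of j "t + (-1) * s"] by simp
        qed
      qed
      also have "\<dots> = 2 * (LINT s|lborel. h j s)"
        using h hr \<open>(LINT s|lborel. h j s) = _\<close> by simp
      finally show ?thesis by (simp add: a_def field_simps)
    qed
    have key: "(\<Sum>j<n. h j s / 4 ^ j) \<le> 40 / 3 * w s" for n s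
    proof -
      \<comment> \<open>On the support of \<open>h j\<close>, this sequence drops by at least \<open>3/40\<close> of \<open>4\<^sup>-\<^sup>j\<close>,
         so that the sum telescopes to \<open>g 0 = 1 / (1 + s\<^sup>2)\<close>.\<close>
      define g where "g j = 1 / (4 ^ j + s\<^sup>2)" for j :: nat
      have gp: "4 ^ j + s\<^sup>2 > 0" for j :: nat by (simp add: add_pos_nonneg)
      have "h j s / 4 ^ j \<le> 40 / 3 * \<bar>p s\<bar> * (g j - g (Suc j))" for j
      proof -
        have gd: "g j - g (Suc j) = 3 * 4 ^ j / ((4 ^ j + s\<^sup>2) * (4 ^ Suc j + s\<^sup>2))"
          unfolding g_def using gp[of j] gp[of "Suc j"] by (subst diff_frac_eq) auto
        show ?thesis
        proof (cases "\<bar>s\<bar> \<le> 2 ^ Suc j")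
          case True
          hence "\<bar>s\<bar>\<^sup>2 \<le> (2 ^ Suc j)\<^sup>2" by (intro power_mono) auto
          hence s: "s\<^sup>2 \<le> 4 * 4 ^ j" by (simp add: power_mult_distrib power_mult[symmetric] mult.commute[of _ 2] power_mult[of 2 2])
          have "(4 ^ j + s\<^sup>2) * (4 ^ Suc j + s\<^sup>2) \<le> (5 * 4 ^ j) * (8 * 4 ^ j)"
            using s gp[of j] gp[of "Suc j"] by (intro mult_mono) auto
          hence "3 * 4 ^ j / ((5 * 4 ^ j) * (8 * 4 ^ j)) \<le> g j - g (Suc j)"
            unfolding gd using gp[of j] gp[of "Suc j"] by (intro divide_left_mono mult_pos_pos) auto
          hence "1 / 4 ^ j \<le> 40 / 3 * (g j - g (Suc j))" by (simp add: field_simps)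
          from mult_left_mono[OF this, of "\<bar>p s\<bar>"] have "\<bar>p s\<bar> / 4 ^ j \<le> 40 / 3 * \<bar>p s\<bar> * (g j - g (Suc j))"
            by (simp add: mult_ac)
          moreover have "h j s \<le> \<bar>p s\<bar>" by (simp add: h_def indicator_def)
          hence "h j s / 4 ^ j \<le> \<bar>p s\<bar> / 4 ^ j" by (intro divide_right_mono) auto
          ultimately show ?thesis by linarith
        next
          case False
          hence "s \<notin> {- (2 ^ Suc j)..2 ^ Suc j}" by auto
          hence "h j s = 0" by (simp add: h_def del: atLeastAtMost_iff)
          thus ?thesis unfolding gd using gp[of j] gp[of "Suc j"] by simp
        qed
      qed
      hence "(\<Sum>j<n. h j s / 4 ^ j) \<le> (\<Sum>j<n. 40 / 3 * \<bar>p s\<bar> * (g j - g (Suc j)))" by (rule sum_mono)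
      also have "\<dots> = 40 / 3 * \<bar>p s\<bar> * (g 0 - g n)"
        unfolding sum_distrib_left[symmetric] sum_lessThan_telescope' ..
      also have "\<dots> \<le> 40 / 3 * \<bar>p s\<bar> * g 0" using gp[of n] by (intro mult_left_mono) (auto simp: g_def)
      finally show ?thesis by (simp add: g_def w_def)
    qed
    show "summable (\<lambda>j. a j / 2 ^ j)"
    proof (rule summableI_nonneg_bounded)
      show "a j / 2 ^ j \<ge> 0" for j using a0 by simp
      show "(\<Sum>j<n. a j / 2 ^ j) \<le> (LINT s|lborel. 40 / 3 * w s)" for n
      proof -
        have "(2::real) ^ j * 2 ^ j = 4 ^ j" for j :: nat by (simp add: power_mult_distrib[symmetric])
        hence "(\<Sum>j<n. a j / 2 ^ j) = (\<Sum>j<n. LINT s|lborel. h j s / 4 ^ j)" by (simp add: a_def)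
        also have "\<dots> = (LINT s|lborel. (\<Sum>j<n. h j s / 4 ^ j))" using h by simp
        also have "\<dots> \<le> (LINT s|lborel. 40 / 3 * w s)" using h w key by (intro integral_mono) auto
        finally show ?thesis .
      qed
    qed
  qed
qed

section \<open>The group and its generator\<close>

lemma scaleC_one [simp]: "1 *C x = (x :: 'a::complex_normed_vector)"
  using scaleR_scaleC[of 1 x] by simp

lemma linear_scaleC: "linear (\<lambda>x. c *C (x :: 'a::complex_normed_vector))"
proof (rule linearI)
  show "c *C (r *\<^sub>R x) = r *\<^sub>R (c *C x)" for r and x :: 'a
    by (simp add: scaleR_scaleC scaleC_scaleC mult.commute)
qed (rule scaleC_add_right)

text \<open>
The usual complexification \<open>\<phi> x - \<i> \<phi> (\<i> x)\<close> of a real functional. It has the norm of \<open>\<phi>\<close>, but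
the cruder bound with the factor \<open>2\<close> is immediate and suffices for estimates up to a constant.
\<close>

lemma norming_complex_functional:
  fixes v :: "'a::complex_normed_vector"
  obtains l :: "'a \<Rightarrow> complex" where "linear l" "\<And>c x. l (c *C x) = c * l x" "\<And>x. norm (l x) \<le> 2 * norm x" "norm v \<le> norm (l v)"
proof -
  obtain \<phi> where \<phi>: "linear \<phi>" "\<And>x. \<bar>\<phi> x\<bar> \<le> norm x" "\<phi> v = norm v"
    using norming_functional by blast
  define l where "l x = Complex (\<phi> x) (- \<phi> (\<i> *C x))" for x
  show ?thesis
  proof (rule that[of l])
    show "linear l"
      using \<phi>(1) by (intro linearI) (auto simp: l_def complex_eq_iff linear_add linear_scale linear_scaleC[THEN linear_scale] scaleC_add_right)
    show "l (c *C x) = c * l x" for c x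
    proof -
      have c: "c *C x = Re c *\<^sub>R x + Im c *\<^sub>R (\<i> *C x)"
      proof -
        have "c = of_real (Re c) + of_real (Im c) * \<i>" by (simp add: complex_eq_iff)
        thus ?thesis by (simp only: scaleR_scaleC scaleC_scaleC scaleC_add_left[symmetric])
      qed
      have ic: "\<i> *C (c *C x) = Re c *\<^sub>R (\<i> *C x) + (- Im c) *\<^sub>R x"
      proof -
        have "\<i> * c = of_real (Re c) * \<i> + of_real (- Im c)" by (simp add: complex_eq_iff)
        thus ?thesis by (simp only: scaleR_scaleC scaleC_scaleC scaleC_add_left[symmetric])
      qed
      show ?thesis
        unfolding l_def ic unfolding c using \<phi>(1) by (simp add: complex_eq_iff linear_add linear_scale linear_diff linear_neg)
    qed
    show "norm (l x) \<le> 2 * norm x" for x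
      using cmod_le[of "l x"] \<phi>(2)[of x] \<phi>(2)[of "\<i> *C x"] by (simp add: l_def norm_scaleC)
    show "norm v \<le> norm (l v)"
      using abs_Re_le_cmod[of "l v"] \<phi>(3) by (simp add: l_def)
  qed
qed

locale nonquasianalytic_group =
  fixes D :: "'a::complex_banach set" and A :: "'a \<Rightarrow> 'a" and U :: "real \<Rightarrow> 'a \<Rightarrow> 'a"
  assumes closed_dense: "closed_densely_defined D A"
    and group: "c0_group U"
    and generator: "is_generator D (\<lambda>y. \<i> *C A y) U"
    and nonquasianalytic: "nonquasianalytic U"
begin

lemma
  shows U_bounded_linear: "bounded_linear (U t)" and U_scaleC: "U t (c *C x) = c *C U t x"
    and U_0: "U 0 x = x" and U_add: "U (s + t) x = U s (U t x)"
  using group by (auto simp: c0_group_def)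

lemma
  shows D_add: "x \<in> D \<Longrightarrow> y \<in> D \<Longrightarrow> x + y \<in> D" and A_add: "x \<in> D \<Longrightarrow> y \<in> D \<Longrightarrow> A (x + y) = A x + A y"
    and D_scaleC: "x \<in> D \<Longrightarrow> c *C x \<in> D" and A_scaleC: "x \<in> D \<Longrightarrow> A (c *C x) = c *C A x"
    and graph_closed: "closed {(x, A x) | x. x \<in> D}" and D_dense: "closure D = UNIV"
  using closed_dense by (auto simp: closed_densely_defined_def)

text \<open>
Written with \<open>exp\<close> and \<open>ln\<close> so as to remain valid on the trivial space, where \<open>onorm\<close> is \<open>0\<close> and the
value of \<open>ln\<close> at \<open>0\<close> is \<open>0\<close> by convention.
\<close>

lemma norm_U_le: "norm (U t x) \<le> exp (ln (onorm (U t))) * norm x"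
proof (cases "onorm (U t) = 0")
  case True thus ?thesis using onorm[OF U_bounded_linear, of t x] by simp
next
  case False
  thus ?thesis using onorm[OF U_bounded_linear, of t x] onorm_pos_le[OF U_bounded_linear, of t] by simp
qed

lemma ln_onorm_subadditive: "ln (onorm (U (s + t))) \<le> ln (onorm (U s)) + ln (onorm (U t))"
proof (cases "\<exists>r. onorm (U r) = 0")
  case True
  then obtain r where "onorm (U r) = 0" by blast
  hence "U r x = 0" for x using onorm_eq_0[OF U_bounded_linear] by blast
  hence "x = 0" for x :: 'a using U_add[of "-r" r x] U_0 linear_0[OF bounded_linear.linear[OF U_bounded_linear]] by simp
  hence "U r = (\<lambda>x. 0)" for r by blast
  hence "onorm (U r) = 0" for r by (simp add: onorm_zero)
  thus ?thesis by simp
next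
  case False
  hence pos: "onorm (U r) > 0" for r using onorm_pos_le[OF U_bounded_linear, of r] by (metis order_le_less)
  have "U (s + t) = U s \<circ> U t" using U_add by (auto simp: o_def)
  hence "onorm (U (s + t)) \<le> onorm (U s) * onorm (U t)"
    using onorm_compose[OF U_bounded_linear U_bounded_linear, of s t] by simp
  hence "ln (onorm (U (s + t))) \<le> ln (onorm (U s) * onorm (U t))"
    using pos by (simp add: ln_le_cancel_iff)
  thus ?thesis using pos by (simp add: ln_mult_pos)
qed

end

section \<open>Smooth vectors and vectors of exponential type\<close>

lemma dom_pow_iff: "x \<in> dom_pow D A n \<longleftrightarrow> (\<forall>k<n. (A ^^ k) x \<in> D)"
  by (induction n) (auto simp: less_Suc_eq)

lemma C_infty_iff: "x \<in> C_infty D A \<longleftrightarrow> (\<forall>k. (A ^^ k) x \<in> D)"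
  by (auto simp: C_infty_def dom_pow_iff)

lemma C_infty_funpow: "x \<in> C_infty D A \<Longrightarrow> (A ^^ k) x \<in> C_infty D A"
  unfolding C_infty_iff using funpow_add[of _ k A] by (metis o_apply)

lemma exp_type_le_mono: "0 \<le> \<alpha> \<Longrightarrow> \<alpha> \<le> \<beta> \<Longrightarrow> exp_type_le \<alpha> D A \<subseteq> exp_type_le \<beta> D A"
proof
  fix x assume \<alpha>: "0 \<le> \<alpha>" "\<alpha> \<le> \<beta>" and "x \<in> exp_type_le \<alpha> D A"
  then obtain c where c: "c > 0" "\<And>k. norm ((A ^^ k) x) \<le> c * \<alpha> ^ k" and x: "x \<in> C_infty D A"
    by (auto simp: exp_type_le_def)
  have "norm ((A ^^ k) x) \<le> c * \<beta> ^ k" for k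
    using c(1) by (intro order_trans[OF c(2)] mult_left_mono power_mono \<alpha>) auto
  thus "x \<in> exp_type_le \<beta> D A" using c(1) x by (auto simp: exp_type_le_def)
qed

text \<open>
Trades the infimum in the definition of the type for a condition on every larger exponent, which is
visibly stable under linear operations.
\<close>

lemma Xi_iff:
  assumes "r > 0"
  shows "y \<in> Xi r D A \<longleftrightarrow> (\<forall>\<alpha>>r. y \<in> exp_type_le \<alpha> D A)"
proof
  assume y: "y \<in> Xi r D A"
  show "\<forall>\<alpha>>r. y \<in> exp_type_le \<alpha> D A"
  proof (intro allI impI)
    fix \<alpha> assume "\<alpha> > r"
    have ne: "{\<alpha>. \<alpha> > 0 \<and> y \<in> exp_type_le \<alpha> D A} \<noteq> {}" using y by (auto simp: Xi_def exp_type_vectors_def)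
    have lt: "Inf {\<alpha>. \<alpha> > 0 \<and> y \<in> exp_type_le \<alpha> D A} < \<alpha>"
      using y \<open>\<alpha> > r\<close> by (auto simp: Xi_def exp_type_def)
    obtain \<beta> where "\<beta> > 0" "y \<in> exp_type_le \<beta> D A" "\<beta> < \<alpha>" using cInf_lessD[OF ne lt] by blast
    thus "y \<in> exp_type_le \<alpha> D A" using exp_type_le_mono[of \<beta> \<alpha>] by auto
  qed
next
  assume y: "\<forall>\<alpha>>r. y \<in> exp_type_le \<alpha> D A"
  have "Inf {\<alpha>. \<alpha> > 0 \<and> y \<in> exp_type_le \<alpha> D A} \<le> \<alpha>" if "\<alpha> > r" for \<alpha>
    using y that assms by (intro cInf_lower) (auto simp: bdd_below_def intro: exI[of _ 0] less_imp_le)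
  hence "exp_type y D A \<le> r" unfolding exp_type_def by (rule dense_ge)
  moreover have "y \<in> exp_type_vectors D A"
    unfolding exp_type_vectors_def using y assms by (intro UN_I[of "r + 1"]) auto
  ultimately show "y \<in> Xi r D A" by (simp add: Xi_def)
qed

lemma Xi_mono: "0 < r \<Longrightarrow> r \<le> s \<Longrightarrow> Xi r D A \<subseteq> Xi s D A"
  by (auto simp: Xi_def)

lemma Xi_imp_C_infty: "y \<in> Xi r D A \<Longrightarrow> y \<in> C_infty D A"
  by (auto simp: Xi_def exp_type_vectors_def exp_type_le_def)

context nonquasianalytic_group
begin

section \<open>Calculus on orbits\<close>

lemma growth_sequence:
  obtains a :: "nat \<Rightarrow> real" where "\<And>j. a j \<ge> 0" "summable (\<lambda>j. a j / 2 ^ j)"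
    "\<And>t j x. \<bar>t\<bar> \<le> 2 ^ j \<Longrightarrow> norm (U t x) \<le> exp (a j) * norm x"
proof -
  obtain a :: "nat \<Rightarrow> real" where a: "\<And>j. a j \<ge> 0" "summable (\<lambda>j. a j / 2 ^ j)"
    "\<And>t j. \<bar>t\<bar> \<le> 2 ^ j \<Longrightarrow> ln (onorm (U t)) \<le> a j"
    using subadditive_dyadic_growth[of "\<lambda>t. ln (onorm (U t))"] ln_onorm_subadditive nonquasianalytic
    unfolding nonquasianalytic_def by blast
  show ?thesis
  proof (rule that[of a])
    show "norm (U t x) \<le> exp (a j) * norm x" if "\<bar>t\<bar> \<le> 2 ^ j" for t j x
      by (rule order_trans[OF norm_U_le]) (use a(3)[OF that] in \<open>intro mult_right_mono, auto\<close>)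
  qed (use a in auto)
qed

lemma U_simps: "U t (x + y) = U t x + U t y" "U t (x - y) = U t x - U t y" "U t (r *\<^sub>R x) = r *\<^sub>R U t x" "U t 0 = 0"
  using bounded_linear.linear[OF U_bounded_linear[of t]] by (auto simp: linear_add linear_diff linear_scale linear_0)

lemma zero_in_D: "0 \<in> D" and A_0: "A 0 = 0"
proof -
  obtain x where x: "x \<in> D" using D_dense by force
  have z: "0 *C x = 0" using linear_0[OF linear_scaleC[of 0]] scaleR_scaleC[of 0 x] by simp
  show "0 \<in> D" using D_scaleC[OF x, of 0] z by simp
  have "0 *C A x = 0" using scaleR_scaleC[of 0 "A x"] by simp
  thus "A 0 = 0" using A_scaleC[OF x, of 0] z by simp
qed

lemma D_diff: "x \<in> D \<Longrightarrow> y \<in> D \<Longrightarrow> x - y \<in> D" and A_diff: "x \<in> D \<Longrightarrow> y \<in> D \<Longrightarrow> A (x - y) = A x - A y"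
proof -
  assume xy: "x \<in> D" "y \<in> D"
  have m: "(- 1) *C z = - z" for z :: 'a using scaleR_scaleC[of "-1" z] by simp
  show "x - y \<in> D" "A (x - y) = A x - A y"
    using D_add[OF xy(1) D_scaleC[OF xy(2), of "-1"]] A_add[OF xy(1) D_scaleC[OF xy(2), of "-1"]] A_scaleC[OF xy(2), of "-1"]
    by (simp_all add: m)
qed

lemma generator_limit: "x \<in> D \<Longrightarrow> ((\<lambda>h. (U h x - x) /\<^sub>R h) \<longlongrightarrow> \<i> *C A x) (at 0)"
  and in_DI: "((\<lambda>h. (U h x - x) /\<^sub>R h) \<longlongrightarrow> y) (at 0) \<Longrightarrow> x \<in> D"
  using generator by (auto simp: is_generator_def)

lemma shifted_limit:
  assumes "x \<in> D"
  shows "((\<lambda>h. (U h (U t x) - U t x) /\<^sub>R h) \<longlongrightarrow> U t (\<i> *C A x)) (at 0)"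
proof -
  have "(U h (U t x) - U t x) /\<^sub>R h = U t ((U h x - x) /\<^sub>R h)" for h
    by (simp add: U_simps add.commute[of h t] flip: U_add)
  thus ?thesis using bounded_linear.tendsto[OF U_bounded_linear generator_limit[OF assms], of t] by simp
qed

lemma U_in_D: "x \<in> D \<Longrightarrow> U t x \<in> D"
  using shifted_limit in_DI by blast

lemma A_U: 
  assumes "x \<in> D" shows "A (U t x) = U t (A x)"
proof -
  have "\<i> *C A (U t x) = U t (\<i> *C A x)"
    using generator_limit[OF U_in_D[OF assms]] shifted_limit[OF assms] by (rule LIM_unique)
  hence "(- \<i>) *C \<i> *C A (U t x) = (- \<i>) *C \<i> *C U t (A x)" by (simp add: U_scaleC)
  thus ?thesis by (simp add: scaleC_scaleC)
qed

lemma U_has_derivative: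
  assumes "x \<in> D"
  shows "((\<lambda>t. U t x) has_vector_derivative U t (\<i> *C A x)) (at t)"
  unfolding has_vector_derivative_def has_derivative_at
proof
  show "bounded_linear (\<lambda>h. h *\<^sub>R U t (\<i> *C A x))" by (rule bounded_linear_scaleR_left)
  have lim: "((\<lambda>h. norm ((U h (U t x) - U t x) /\<^sub>R h - U t (\<i> *C A x))) \<longlongrightarrow> 0) (at 0)"
    using tendsto_norm_zero[OF LIM_zero[OF shifted_limit[OF assms, of t]]] .
  have eq: "norm ((U h (U t x) - U t x) /\<^sub>R h - U t (\<i> *C A x))
      = norm (U (t + h) x - U t x - h *\<^sub>R U t (\<i> *C A x)) / norm h" if "h \<noteq> 0" for h
  proof -
    have "(U h (U t x) - U t x) /\<^sub>R h - U t (\<i> *C A x) = (U (t + h) x - U t x - h *\<^sub>R U t (\<i> *C A x)) /\<^sub>R h"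
      using that unfolding U_add[of h t, symmetric] add.commute[of h t] by (simp add: scaleR_diff_right)
    thus ?thesis using that by (simp add: divide_inverse)
  qed
  show "((\<lambda>h. norm (U (t + h) x - U t x - h *\<^sub>R U t (\<i> *C A x)) / norm h) \<longlongrightarrow> 0) (at 0)"
    by (rule Lim_transform_within[OF lim zero_less_one]) (use eq in auto)
qed

lemma funpow_A_diff:
  assumes "x \<in> C_infty D A" "y \<in> C_infty D A"
  shows "(A ^^ k) (x - y) = (A ^^ k) x - (A ^^ k) y"
  using assms by (induction k) (auto simp: C_infty_iff A_diff)

lemma C_infty_diff: "x \<in> C_infty D A \<Longrightarrow> y \<in> C_infty D A \<Longrightarrow> x - y \<in> C_infty D A"
  using funpow_A_diff D_diff by (simp add: C_infty_iff)

lemma Xi_diff: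
  assumes "r > 0" "x \<in> Xi r D A" "y \<in> Xi r D A"
  shows "x - y \<in> Xi r D A"
  unfolding Xi_iff[OF assms(1)]
proof (intro allI impI)
  fix \<alpha> assume "\<alpha> > r"
  hence "x \<in> exp_type_le \<alpha> D A" "y \<in> exp_type_le \<alpha> D A" using assms Xi_iff[THEN iffD1, rule_format] by blast+
  then obtain c d where cd: "c > 0" "d > 0" "\<And>k. norm ((A ^^ k) x) \<le> c * \<alpha> ^ k" "\<And>k. norm ((A ^^ k) y) \<le> d * \<alpha> ^ k"
    and C: "x \<in> C_infty D A" "y \<in> C_infty D A"
    by (auto simp: exp_type_le_def)
  have "norm ((A ^^ k) (x - y)) \<le> (c + d) * \<alpha> ^ k" for k
    unfolding funpow_A_diff[OF C] distrib_right using cd(3,4)[of k] by (rule norm_triangle_le_diff[OF add_mono])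
  thus "x - y \<in> exp_type_le \<alpha> D A"
    using C_infty_diff[OF C] cd(1,2) unfolding exp_type_le_def by (auto intro!: exI[of _ "c + d"])
qed

lemma zero_in_Xi: "r > 0 \<Longrightarrow> 0 \<in> Xi r D A"
proof -
  assume r: "r > 0"
  have "(A ^^ k) 0 = 0" for k by (induction k) (auto simp: A_0)
  thus "0 \<in> Xi r D A" unfolding Xi_iff[OF r] exp_type_le_def using r zero_in_D
    by (auto simp: C_infty_iff intro: exI[of _ 1])
qed

text \<open>
A vector of exponential type has an orbit that extends to an entire function. The proof works with
one real functional at a time, where Taylor's formula with remainder is at hand.
\<close>

lemma orbit_power_series_real:
  assumes w: "w \<in> C_infty D A" and b: "\<And>k. norm ((A ^^ k) w) \<le> c * \<alpha> ^ k"
    and \<phi>: "bounded_linear (\<phi> :: 'a \<Rightarrow> real)"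
  shows "(\<lambda>k. \<phi> (\<i> ^ k *C (A ^^ k) w) * t ^ k / fact k) sums \<phi> (U t w)"
proof -
  obtain a :: "nat \<Rightarrow> real" where a: "\<And>j. a j \<ge> 0" "\<And>t j x. \<bar>t\<bar> \<le> 2 ^ j \<Longrightarrow> norm (U t x) \<le> exp (a j) * norm x"
    using growth_sequence by metis
  obtain K where K: "K > 0" "\<And>x. norm (\<phi> x) \<le> norm x * K" using bounded_linear.pos_bounded[OF \<phi>] by blast
  obtain j where j: "\<bar>t\<bar> < 2 ^ j" using real_arch_pow[of 2 "\<bar>t\<bar>"] by auto
  define diff where "diff k s = \<phi> (U s (\<i> ^ k *C (A ^^ k) w))" for k s
  have der: "DERIV (diff k) s :> diff (Suc k) s" for k s
  proof -
    have d: "\<i> ^ k *C (A ^^ k) w \<in> D" and A: "A (\<i> ^ k *C (A ^^ k) w) = \<i> ^ k *C (A ^^ Suc k) w"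
      using w by (auto simp: C_infty_iff D_scaleC A_scaleC)
    have "(diff k has_vector_derivative \<phi> (U s (\<i> *C A (\<i> ^ k *C (A ^^ k) w)))) (at s)"
      unfolding diff_def by (rule bounded_linear.has_vector_derivative[OF \<phi> U_has_derivative[OF d]])
    moreover have "\<i> *C A (\<i> ^ k *C (A ^^ k) w) = \<i> ^ Suc k *C (A ^^ Suc k) w"
      unfolding A by (simp add: scaleC_scaleC)
    ultimately show ?thesis by (simp add: diff_def has_real_derivative_iff_has_vector_derivative)
  qed
  have bound: "\<bar>diff n s / fact n * t ^ n\<bar> \<le> exp (a j) * c * K * (inverse (fact n) * (\<alpha> * \<bar>t\<bar>) ^ n)" if "\<bar>s\<bar> \<le> \<bar>t\<bar>" for n s
  proof -
    have "norm (diff n s) \<le> norm (U s (\<i> ^ n *C (A ^^ n) w)) * K" unfolding diff_def by (rule K)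
    also have "\<dots> \<le> (exp (a j) * norm (\<i> ^ n *C (A ^^ n) w)) * K"
      using a(2)[of s j] that j K(1) by (intro mult_right_mono) auto
    also have "\<dots> \<le> (exp (a j) * (c * \<alpha> ^ n)) * K"
      using b[of n] K(1) by (intro mult_right_mono mult_left_mono) (auto simp: norm_scaleC norm_power)
    finally have "norm (diff n s) * (\<bar>t\<bar> ^ n / fact n) \<le> (exp (a j) * (c * \<alpha> ^ n)) * K * (\<bar>t\<bar> ^ n / fact n)"
      by (intro mult_right_mono) auto
    thus ?thesis by (simp add: abs_mult power_abs power_mult_distrib field_simps)
  qed
  have lim: "(\<lambda>n. exp (a j) * c * K * (inverse (fact n) * (\<alpha> * \<bar>t\<bar>) ^ n)) \<longlonglongrightarrow> 0"
    using summable_LIMSEQ_zero[OF summable_exp[of "\<alpha> * \<bar>t\<bar>"]] by (rule tendsto_mult_right_zero)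
  have rem: "norm (\<phi> (U t w) - (\<Sum>k<n. diff k 0 / fact k * t ^ k)) \<le> exp (a j) * c * K * (inverse (fact n) * (\<alpha> * \<bar>t\<bar>) ^ n)" for n
  proof -
    obtain s where s: "\<bar>s\<bar> \<le> \<bar>t\<bar>" "diff 0 t = (\<Sum>k<n. diff k 0 / fact k * t ^ k) + diff n s / fact n * t ^ n"
      using Maclaurin_bi_le[of diff "diff 0" n t] der by blast
    have "diff 0 t = \<phi> (U t w)" by (simp add: diff_def)
    hence "\<phi> (U t w) - (\<Sum>k<n. diff k 0 / fact k * t ^ k) = diff n s / fact n * t ^ n" using s(2) by linarith
    thus ?thesis using bound[OF s(1), of n] by (simp only: real_norm_def)
  qed
  have "(\<lambda>n. \<phi> (U t w) - (\<Sum>k<n. diff k 0 / fact k * t ^ k)) \<longlonglongrightarrow> 0"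
    using rem by (intro Lim_null_comparison[OF _ lim] always_eventually) blast
  hence "(\<lambda>n. \<phi> (U t w) - (\<phi> (U t w) - (\<Sum>k<n. diff k 0 / fact k * t ^ k))) \<longlonglongrightarrow> \<phi> (U t w) - 0"
    by (intro tendsto_intros)
  hence "(\<lambda>k. diff k 0 / fact k * t ^ k) sums \<phi> (U t w)" by (simp add: sums_def)
  thus ?thesis by (simp add: diff_def U_0)
qed

lemma orbit_power_series:
  assumes w: "w \<in> C_infty D A" and b: "\<And>k. norm ((A ^^ k) w) \<le> c * \<alpha> ^ k"
    and l: "bounded_linear (l :: 'a \<Rightarrow> complex)"
  shows "(\<lambda>k. l (\<i> ^ k *C (A ^^ k) w) * of_real t ^ k / fact k) sums l (U t w)"
proof -
  have f: "l (\<i> ^ k *C (A ^^ k) w) * of_real t ^ k / fact k = (t ^ k / fact k) *\<^sub>R l (\<i> ^ k *C (A ^^ k) w)" for k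
    by (simp add: scaleR_conv_of_real)
  have "bounded_linear (\<lambda>x. Re (l x))" "bounded_linear (\<lambda>x. Im (l x))"
    using bounded_linear_compose[OF bounded_linear_Re l] bounded_linear_compose[OF bounded_linear_Im l] by auto
  from this[THEN orbit_power_series_real[OF w b, where t=t]] show ?thesis
    unfolding f sums_complex_iff by (simp add: mult.commute)
qed

section \<open>Bernstein's inequality\<close>

text \<open>
The time scale is normalised by \<open>t / r\<close>, which makes the type at most \<open>2\<close>. Because \<open>\<bar>t / r\<bar> \<le> \<bar>t\<bar>\<close> for
\<open>r \<ge> 1\<close>, the same weight \<open>a\<close> controls the rescaled orbits for all \<open>r\<close>, which gives a constant
independent of \<open>r\<close>.
\<close>

theorem Bernstein_inequality:
  obtains C where "C > 0" "\<And>r y k. r \<ge> 1 \<Longrightarrow> y \<in> Xi r D A \<Longrightarrow> norm ((A ^^ k) y) \<le> C * fact k * r ^ k * norm y"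
proof -
  obtain a :: "nat \<Rightarrow> real" where a: "\<And>j. a j \<ge> 0" "summable (\<lambda>j. a j / 2 ^ j)" 
    "\<And>t j x. \<bar>t\<bar> \<le> 2 ^ j \<Longrightarrow> norm (U t x) \<le> exp (a j) * norm x"
    using growth_sequence by metis
  obtain C where C: "C > 0" "\<And>(u :: nat \<Rightarrow> complex) c M k. (\<And>k. norm (u k) \<le> c * 2 ^ k / fact k) \<Longrightarrow> M > 0 \<Longrightarrow>
       (\<And>t j. \<bar>t\<bar> \<le> 2 ^ j \<Longrightarrow> norm (\<Sum>k. u k * of_real t ^ k) \<le> M * exp (a j)) \<Longrightarrow> norm (u k) \<le> C * M"
    using power_series_coefficient_bound[OF a(1,2)] by blast
  show ?thesis
  proof (rule that[of "2 * C"])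
    show "2 * C > 0" using C by simp
    fix r :: real and y k assume r: "r \<ge> 1" and y: "y \<in> Xi r D A"
    have "y \<in> exp_type_le (2 * r) D A" using Xi_iff[THEN iffD1, rule_format, OF _ y, of "2 * r"] r by simp
    then obtain c where c: "\<And>k. norm ((A ^^ k) y) \<le> c * (2 * r) ^ k" and yC: "y \<in> C_infty D A"
      by (auto simp: exp_type_le_def)
    show "norm ((A ^^ k) y) \<le> 2 * C * fact k * r ^ k * norm y"
    proof (cases "y = 0")
      case True
      have "(A ^^ k) 0 = 0" for k by (induction k) (auto simp: A_0)
      thus ?thesis using True by simp
    next
      case False
      obtain l where l: "linear l" "\<And>c x. l (c *C x) = c * l x" "\<And>x. norm (l x) \<le> 2 * norm x"
        "norm ((A ^^ k) y) \<le> norm (l ((A ^^ k) y))"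
        using norming_complex_functional[of "(A ^^ k) y"] by blast
      have bl: "bounded_linear l"
        using l(1,3) by (intro bounded_linear_intro[of _ 2]) (auto simp: linear_add linear_scale mult.commute)
      define u where "u k = l (\<i> ^ k *C (A ^^ k) y) / (of_real r ^ k * fact k)" for k
      have nu: "norm (u k) = norm (l ((A ^^ k) y)) / (r ^ k * fact k)" for k
        using r by (simp add: u_def l(2) norm_mult norm_divide norm_power)
      have "norm (u k) \<le> C * (2 * norm y)"
      proof (rule C(2))
        show "2 * norm y > 0" using False by simp
        show "norm (u k) \<le> (2 * c) * 2 ^ k / fact k" for k
        proof -
          have "norm (l ((A ^^ k) y)) \<le> 2 * (c * (2 * r) ^ k)" using l(3)[of "(A ^^ k) y"] c[of k] by simp
          hence "norm (u k) \<le> 2 * (c * (2 * r) ^ k) / (r ^ k * fact k)"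
            unfolding nu using r by (intro divide_right_mono) auto
          thus ?thesis using r by (simp add: power_mult_distrib)
        qed
        show "norm (\<Sum>k. u k * of_real t ^ k) \<le> 2 * norm y * exp (a j)" if t: "\<bar>t\<bar> \<le> 2 ^ j" for t j
        proof -
          have "u k * of_real t ^ k = l (\<i> ^ k *C (A ^^ k) y) * of_real (t / r) ^ k / fact k" for k
            by (simp add: u_def power_divide)
          hence "(\<lambda>k. u k * of_real t ^ k) sums l (U (t / r) y)"
            using orbit_power_series[OF yC c bl, of "t / r"] by simp
          hence "norm (\<Sum>k. u k * of_real t ^ k) = norm (l (U (t / r) y))" by (simp add: sums_iff)
          also have "\<dots> \<le> 2 * norm (U (t / r) y)" by (rule l)
          also have "\<dots> \<le> 2 * (exp (a j) * norm y)"
          proof -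
            have "\<bar>t / r\<bar> \<le> \<bar>t\<bar>" using r mult_right_mono[OF r, of "\<bar>t\<bar>"] by (simp add: abs_divide divide_simps mult.commute)
            thus ?thesis using a(3)[of "t / r" j y] t by simp
          qed
          finally show ?thesis by (simp add: mult_ac)
        qed
      qed
      hence "norm (l ((A ^^ k) y)) \<le> C * (2 * norm y) * (r ^ k * fact k)"
        unfolding nu using r by (simp add: divide_le_eq)
      thus ?thesis using l(4) by (simp add: mult_ac)
    qed
  qed
qed

section \<open>Differences of the group\<close>

text \<open>
The crude estimate of differences, for the high frequencies; \<open>group_diff_smooth\<close> is its counterpart
for the low ones.
\<close>

lemma group_diff_bounded:
  assumes "\<And>x. norm (U \<tau> x) \<le> K * norm x" "K \<ge> 0"
  shows "norm (group_diff U k \<tau> x) \<le> (K + 1) ^ k * norm x"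
proof (induction k)
  case (Suc k)
  have "norm (group_diff U (Suc k) \<tau> x) \<le> norm (U \<tau> (group_diff U k \<tau> x)) + norm (group_diff U k \<tau> x)"
    by (simp add: group_diff_def norm_triangle_ineq4)
  also have "\<dots> \<le> (K + 1) * norm (group_diff U k \<tau> x)" using assms(1)[of "group_diff U k \<tau> x"] by (simp add: algebra_simps)
  also have "\<dots> \<le> (K + 1) * ((K + 1) ^ k * norm x)" using Suc assms(2) by (intro mult_left_mono) auto
  finally show ?case by (simp add: mult_ac)
qed (simp add: group_diff_def)

lemma group_diff_in_D: "x \<in> D \<Longrightarrow> group_diff U k \<tau> x \<in> D \<and> A (group_diff U k \<tau> x) = group_diff U k \<tau> (A x)"
  by (induction k) (auto simp: group_diff_def U_in_D D_diff A_diff A_U)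

lemma linear_group_diff: "group_diff U k \<tau> (x - y) = group_diff U k \<tau> x - group_diff U k \<tau> y"
  by (induction k) (auto simp: group_diff_def U_simps)

lemma norm_U_diff_le:
  assumes K: "\<And>t x. \<bar>t\<bar> \<le> 1 \<Longrightarrow> norm (U t x) \<le> K * norm x" and \<tau>: "0 \<le> \<tau>" "\<tau> \<le> 1" and x: "x \<in> D"
  shows "norm (U \<tau> x - x) \<le> K * \<tau> * norm (A x)"
proof -
  have "norm (U \<tau> x - U 0 x) \<le> (K * norm (A x)) * norm (\<tau> - 0)"
  proof (rule differentiable_bound[where S="{0..\<tau>}" and f'="\<lambda>t h. h *\<^sub>R U t (\<i> *C A x)"])
    show "((\<lambda>t. U t x) has_derivative (\<lambda>h. h *\<^sub>R U t (\<i> *C A x))) (at t within {0..\<tau>})" for t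
      using has_vector_derivative_at_within[OF U_has_derivative[OF x]] by (simp add: has_vector_derivative_def)
    show "onorm (\<lambda>h. h *\<^sub>R U t (\<i> *C A x)) \<le> K * norm (A x)" if "t \<in> {0..\<tau>}" for t
    proof -
      have "onorm (\<lambda>h. h *\<^sub>R U t (\<i> *C A x)) = norm (U t (\<i> *C A x))"
        by (simp add: onorm_scaleR_left[OF bounded_linear_ident] onorm_id)
      also have "\<dots> \<le> K * norm (A x)" using K[of t "\<i> *C A x"] that \<tau> by (simp add: norm_scaleC)
      finally show ?thesis .
    qed
  qed (use \<tau> in auto)
  thus ?thesis using \<tau> by (simp add: U_0 mult_ac)
qed

text \<open>
Each of the \<open>k\<close> differences is traded for one power of \<open>A\<close> and a factor \<open>\<tau>\<close> by the mean value
inequality; this is possible because \<open>A\<close> commutes with differences.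
\<close>

lemma group_diff_smooth:
  assumes K: "\<And>t x. \<bar>t\<bar> \<le> 1 \<Longrightarrow> norm (U t x) \<le> K * norm x" and K0: "K \<ge> 0" and \<tau>: "0 \<le> \<tau>" "\<tau> \<le> 1"
    and w: "w \<in> C_infty D A"
  shows "norm (group_diff U k \<tau> w) \<le> (K * \<tau>) ^ k * norm ((A ^^ k) w)"
  using w
proof (induction k arbitrary: w)
  case (Suc k)
  have wD: "w \<in> D" using Suc.prems unfolding C_infty_iff by (metis funpow_0)
  have "norm (group_diff U (Suc k) \<tau> w) = norm (U \<tau> (group_diff U k \<tau> w) - group_diff U k \<tau> w)"
    by (simp add: group_diff_def)
  also have "\<dots> \<le> K * \<tau> * norm (group_diff U k \<tau> (A w))"
    using norm_U_diff_le[OF K \<tau>, of "group_diff U k \<tau> w"] group_diff_in_D[OF wD, of k \<tau>] by simp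
  also have "\<dots> \<le> K * \<tau> * ((K * \<tau>) ^ k * norm ((A ^^ k) (A w)))"
    using Suc.IH[of "A w"] C_infty_funpow[OF Suc.prems, of 1] K0 \<tau> by (intro mult_left_mono) auto
  finally show ?case by (simp add: mult_ac funpow_swap1)
qed (simp add: group_diff_def)

end

section \<open>Moduli of continuity and dyadic sums\<close>

lemma dyadic_sum_le_integral:
  fixes g :: "real \<Rightarrow> real" and b :: "nat \<Rightarrow> real"
  assumes int: "set_integrable lborel S g" and nonneg: "\<And>u. u \<in> S \<Longrightarrow> 0 \<le> g u" and F: "finite F"
    and sub: "\<And>j. j \<in> F \<Longrightarrow> {(1/2) ^ Suc j<..(1/2) ^ j} \<subseteq> S"
    and le: "\<And>j u. j \<in> F \<Longrightarrow> u \<in> {(1/2) ^ Suc j<..(1/2) ^ j} \<Longrightarrow> b j \<le> g u"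
  shows "(\<Sum>j\<in>F. b j * (1/2) ^ Suc j) \<le> (LBINT u:S. g u)"
proof -
  define I where "I j = {(1/2) ^ Suc j<..(1/2::real) ^ j}" for j :: nat
  have disj: "i = j" if "u \<in> I i" "u \<in> I j" for u i j
  proof -
    have "\<not> i < j" if "u \<in> I i" "u \<in> I j" for i j
    proof
      assume "i < j"
      hence "(1/2::real) ^ j \<le> (1/2) ^ Suc i" by (intro power_decreasing) auto
      thus False using that by (auto simp: I_def)
    qed
    from this[of i j] this[of j i] that show ?thesis by linarith
  qed
  have I: "integrable lborel (\<lambda>u. b j * indicator (I j) u)" "(LINT u|lborel. b j * indicator (I j) u) = b j * (1/2) ^ Suc j" for j
    by (auto simp: I_def)
  have "(\<Sum>j\<in>F. b j * (1/2) ^ Suc j) = (LINT u|lborel. (\<Sum>j\<in>F. b j * indicator (I j) u))"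
    by (simp only: Bochner_Integration.integral_sum[OF I(1)] I(2))
  also have "\<dots> \<le> (LINT u|lborel. indicator S u *\<^sub>R g u)"
  proof (rule integral_mono)
    show "integrable lborel (\<lambda>u. \<Sum>j\<in>F. b j * indicator (I j) u)" using I by (intro Bochner_Integration.integrable_sum) auto
    show "integrable lborel (\<lambda>u. indicator S u *\<^sub>R g u)" using int by (simp add: set_integrable_def)
    show "(\<Sum>j\<in>F. b j * indicator (I j) u) \<le> indicator S u *\<^sub>R g u" for u
    proof (cases "\<exists>i\<in>F. u \<in> I i")
      case True
      then obtain i where i: "i \<in> F" "u \<in> I i" by blast
      have "(\<Sum>j\<in>F. b j * indicator (I j) u) = (\<Sum>j\<in>F. if j = i then b j else 0)"
        using i disj by (intro sum.cong) (auto simp: indicator_def)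
      also have "\<dots> = b i" using F i by simp
      also have "\<dots> \<le> g u" using le[OF i(1)] i(2) by (simp add: I_def)
      finally show ?thesis using sub[OF i(1)] i(2) by (auto simp: I_def)
    next
      case False
      hence "(\<Sum>j\<in>F. b j * indicator (I j) u) = 0" by (intro sum.neutral) auto
      thus ?thesis using nonneg[of u] by (simp add: indicator_def)
    qed
  qed
  finally show ?thesis by (simp add: set_lebesgue_integral_def)
qed

lemma modulus_type_doubling:
  assumes "modulus_type \<omega>"
  obtains c where "c > 0" "\<And>t. 0 \<le> t \<Longrightarrow> t \<le> 1 \<Longrightarrow> \<omega> (2 * t) \<le> c * \<omega> t"
  using assms unfolding modulus_type_def by force

lemma modulus_type_mono: "modulus_type \<omega> \<Longrightarrow> 0 \<le> s \<Longrightarrow> s \<le> t \<Longrightarrow> \<omega> s \<le> \<omega> t"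
  by (auto simp: modulus_type_def mono_on_def)

lemma modulus_type_nonneg: "modulus_type \<omega> \<Longrightarrow> 0 \<le> t \<Longrightarrow> 0 \<le> \<omega> t"
  using modulus_type_mono[of \<omega> 0 t] by (simp add: modulus_type_def)

text \<open>
A zero of \<open>\<omega>\<close> at \<open>t > 0\<close> would spread to \<open>[0, 1]\<close> by repeated doubling. Positivity leaves room
between the best approximation and its bound, and allows a constant to be absorbed into the integrals
of \<open>\<omega>\<close>.
\<close>

lemma modulus_type_pos:
  assumes \<omega>: "modulus_type \<omega>" and nz: "\<exists>t\<in>{0..1}. \<omega> t \<noteq> 0" and t: "0 < t"
  shows "\<omega> t > 0"
proof (rule ccontr)
  assume "\<not> \<omega> t > 0"
  hence t0: "\<omega> t \<le> 0" by simp
  obtain c where c: "c > 0" "\<And>t. 0 \<le> t \<Longrightarrow> t \<le> 1 \<Longrightarrow> \<omega> (2 * t) \<le> c * \<omega> t"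
    using modulus_type_doubling[OF \<omega>] by blast
  have zero: "\<omega> s \<le> 0" if "0 \<le> s" "s \<le> 1" "s \<le> 2 ^ i * t" for i s
    using that
  proof (induction i arbitrary: s)
    case 0
    thus ?case using modulus_type_mono[OF \<omega>, of s t] t0 by simp
  next
    case (Suc i)
    have "\<omega> (2 * (s / 2)) \<le> c * \<omega> (s / 2)" using Suc.prems by (intro c) auto
    also have "\<omega> (s / 2) \<le> 0" using Suc.prems by (intro Suc.IH) auto
    hence "c * \<omega> (s / 2) \<le> 0" using c(1) by (simp add: mult_nonneg_nonpos)
    finally show ?case by simp
  qed
  obtain i where i: "1 / t < 2 ^ i" using real_arch_pow[of 2 "1 / t"] by auto
  have "\<omega> s = 0" if "s \<in> {0..1}" for s
  proof -
    have "s \<le> 2 ^ i * t" using that i t by (auto simp: field_simps)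
    thus ?thesis using zero[of s i] modulus_type_nonneg[OF \<omega>, of s] that by auto
  qed
  thus False using nz by blast
qed

lemma set_integrable_modulus:
  assumes \<omega>: "modulus_type \<omega>"
  shows "0 < t \<Longrightarrow> set_integrable lborel {t..1} (\<lambda>u. \<omega> u / u ^ (k + 1))"
    and "t \<le> 1 \<Longrightarrow> set_integrable lborel {0<..t} (\<lambda>u. \<omega> u / u)"
proof -
  assume t: "0 < t"
  show "set_integrable lborel {t..1} (\<lambda>u. \<omega> u / u ^ (k + 1))"
  proof (rule borel_integrable_atLeastAtMost')
    have "continuous_on {t..1} \<omega>"
      using \<omega> t by (auto simp: modulus_type_def intro: continuous_on_subset)
    thus "continuous_on {t..1} (\<lambda>u. \<omega> u / u ^ (k + 1))" using t by (intro continuous_intros) auto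
  qed
next
  assume "t \<le> 1"
  thus "set_integrable lborel {0<..t} (\<lambda>u. \<omega> u / u)"
    using \<omega> by (auto simp: modulus_type_def intro: set_integrable_subset)
qed

text \<open>
On the dyadic interval with right end \<open>(1/2) ^ j\<close>, monotonicity bounds \<open>\<omega>\<close> below by its value at the left end,
and the doubling condition moves that value back to \<open>(1/2) ^ j\<close>. For the second sum the whole
comparison is shifted by one more step, since the intervals have to lie inside \<open>(0, t]\<close> although
\<open>(1/2) ^ J\<close> may exceed \<open>t\<close>; this causes the square of \<open>c\<close>.
\<close>

lemma
  assumes \<omega>: "modulus_type \<omega>" and c: "c > 0" "\<And>t. 0 \<le> t \<Longrightarrow> t \<le> 1 \<Longrightarrow> \<omega> (2 * t) \<le> c * \<omega> t"
    and t: "0 < t" "t \<le> 1"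
  shows low_frequency_sum: "t \<le> (1/2) ^ J \<Longrightarrow> (\<Sum>j<J. 2 ^ (j * k) * \<omega> ((1/2) ^ j)) \<le> 2 * c * (LBINT u:{t..1}. \<omega> u / u ^ (k + 1))"
    and high_frequency_sum: "(1/2) ^ Suc J \<le> t \<Longrightarrow> (\<Sum>j=J..<N. \<omega> ((1/2) ^ j)) \<le> 2 * c\<^sup>2 * (LBINT u:{0<..t}. \<omega> u / u)"
proof -
  have step: "\<omega> ((1/2) ^ j) \<le> c * \<omega> ((1/2) ^ Suc j)" for j
    using c(2)[of "(1/2) ^ Suc j"] power_le_one[of "1/2 :: real" "Suc j"] by simp
  show "(\<Sum>j<J. 2 ^ (j * k) * \<omega> ((1/2) ^ j)) \<le> 2 * c * (LBINT u:{t..1}. \<omega> u / u ^ (k + 1))" if tJ: "t \<le> (1/2) ^ J"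
  proof -
    define b where "b j = \<omega> ((1/2) ^ Suc j) * 2 ^ (j * (k + 1))" for j
    have int: "(\<Sum>j<J. b j * (1/2) ^ Suc j) \<le> (LBINT u:{t..1}. \<omega> u / u ^ (k + 1))"
    proof (rule dyadic_sum_le_integral)
      show "set_integrable lborel {t..1} (\<lambda>u. \<omega> u / u ^ (k + 1))" by (rule set_integrable_modulus) fact+
      show "0 \<le> \<omega> u / u ^ (k + 1)" if "u \<in> {t..1}" for u using that t modulus_type_nonneg[OF \<omega>, of u] by auto
      show "{(1/2) ^ Suc j<..(1/2) ^ j} \<subseteq> {t..1}" if "j \<in> {..<J}" for j
      proof -
        have "(1/2::real) ^ J \<le> (1/2) ^ Suc j" using that by (intro power_decreasing) auto
        moreover have "(1/2::real) ^ j \<le> 1" by (simp add: power_le_one)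
        ultimately show ?thesis using tJ by auto
      qed
      show "b j \<le> \<omega> u / u ^ (k + 1)" if u: "u \<in> {(1/2) ^ Suc j<..(1/2) ^ j}" for j u
      proof -
        have u0: "0 < u" using u less_trans[of 0 "(1/2::real) ^ Suc j" u] by simp
        have "u ^ (k + 1) \<le> ((1/2) ^ j) ^ (k + 1)" using u u0 by (intro power_mono) auto
        hence "2 ^ (j * (k + 1)) \<le> 1 / u ^ (k + 1)"
          using u0 by (simp add: power_mult[symmetric] power_divide power_add field_simps)
        moreover have "\<omega> ((1/2) ^ Suc j) \<le> \<omega> u" using u by (intro modulus_type_mono[OF \<omega>]) auto
        ultimately have "b j \<le> \<omega> u * (1 / u ^ (k + 1))"
          unfolding b_def using modulus_type_nonneg[OF \<omega>, of u] u0 by (intro mult_mono) auto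
        thus ?thesis by simp
      qed
    qed auto
    have "2 ^ (j * k) * \<omega> ((1/2) ^ j) \<le> 2 * c * (b j * (1/2) ^ Suc j)" for j
    proof -
      have "2 ^ (j * k) * \<omega> ((1/2) ^ j) \<le> 2 ^ (j * k) * (c * \<omega> ((1/2) ^ Suc j))" by (intro mult_left_mono step) auto
      also have "\<dots> = 2 * c * (b j * (1/2) ^ Suc j)"
        unfolding b_def by (simp add: power_add power_divide)
      finally show ?thesis .
    qed
    hence "(\<Sum>j<J. 2 ^ (j * k) * \<omega> ((1/2) ^ j)) \<le> 2 * c * (\<Sum>j<J. b j * (1/2) ^ Suc j)"
      unfolding sum_distrib_left by (rule sum_mono)
    also have "\<dots> \<le> 2 * c * (LBINT u:{t..1}. \<omega> u / u ^ (k + 1))" using c(1) by (intro mult_left_mono int) auto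
    finally show ?thesis .
  qed
  show "(\<Sum>j=J..<N. \<omega> ((1/2) ^ j)) \<le> 2 * c\<^sup>2 * (LBINT u:{0<..t}. \<omega> u / u)" if tJ: "(1/2) ^ Suc J \<le> t"
  proof -
    define b where "b j = \<omega> ((1/2) ^ Suc j) * 2 ^ j" for j
    have int: "(\<Sum>j=Suc J..<Suc N. b j * (1/2) ^ Suc j) \<le> (LBINT u:{0<..t}. \<omega> u / u)"
    proof (rule dyadic_sum_le_integral)
      show "set_integrable lborel {0<..t} (\<lambda>u. \<omega> u / u)" by (rule set_integrable_modulus) fact+
      show "0 \<le> \<omega> u / u" if "u \<in> {0<..t}" for u using that t modulus_type_nonneg[OF \<omega>, of u] by auto
      show "{(1/2) ^ Suc j<..(1/2) ^ j} \<subseteq> {0<..t}" if "j \<in> {Suc J..<Suc N}" for j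
      proof -
        have "(1/2::real) ^ j \<le> (1/2) ^ Suc J" using that by (intro power_decreasing) auto
        moreover have "(1/2::real) ^ Suc j > 0" by simp
        ultimately show ?thesis using tJ
          unfolding subset_iff greaterThanAtMost_iff by (meson less_trans order_trans)
      qed
      show "b j \<le> \<omega> u / u" if u: "u \<in> {(1/2) ^ Suc j<..(1/2) ^ j}" for j u
      proof -
        have u0: "0 < u" using u less_trans[of 0 "(1/2::real) ^ Suc j" u] by simp
        have "2 ^ j \<le> 1 / u" using u u0 by (simp add: power_divide field_simps)
        moreover have "\<omega> ((1/2) ^ Suc j) \<le> \<omega> u" using u by (intro modulus_type_mono[OF \<omega>]) auto
        ultimately have "b j \<le> \<omega> u * (1 / u)"
          unfolding b_def using modulus_type_nonneg[OF \<omega>, of u] u0 by (intro mult_mono) auto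
        thus ?thesis by simp
      qed
    qed auto
    have "\<omega> ((1/2) ^ j) \<le> 2 * c\<^sup>2 * (b (Suc j) * (1/2) ^ Suc (Suc j))" for j
    proof -
      have "\<omega> ((1/2) ^ j) \<le> c * \<omega> ((1/2) ^ Suc j)" by (rule step)
      also have "\<dots> \<le> c * (c * \<omega> ((1/2) ^ Suc (Suc j)))" using c(1) by (intro mult_left_mono step) auto
      also have "\<dots> = 2 * c\<^sup>2 * (b (Suc j) * (1/2) ^ Suc (Suc j))"
        unfolding b_def by (simp add: power_divide power2_eq_square)
      finally show ?thesis .
    qed
    hence "(\<Sum>j=J..<N. \<omega> ((1/2) ^ j)) \<le> 2 * c\<^sup>2 * (\<Sum>j=J..<N. b (Suc j) * (1/2) ^ Suc (Suc j))"
      unfolding sum_distrib_left by (rule sum_mono)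
    also have "(\<Sum>j=J..<N. b (Suc j) * (1/2) ^ Suc (Suc j)) = (\<Sum>j=Suc J..<Suc N. b j * (1/2) ^ Suc j)"
      by (rule sum.shift_bounds_Suc_ivl[symmetric])
    also have "2 * c\<^sup>2 * \<dots> \<le> 2 * c\<^sup>2 * (LBINT u:{0<..t}. \<omega> u / u)" by (intro mult_left_mono int) auto
    finally show ?thesis .
  qed
qed

context nonquasianalytic_group
begin

section \<open>The inverse theorem\<close>

text \<open>
Closedness of \<open>A\<close>, applied \<open>n\<close> times: convergence of all the images identifies their limits and
puts \<open>x\<close> into the domain.
\<close>

lemma funpow_A_tendsto:
  assumes y: "\<And>j. y j \<in> C_infty D A" and lim: "y \<longlonglongrightarrow> x"
    and conv: "\<And>i. i \<le> n \<Longrightarrow> convergent (\<lambda>j. (A ^^ i) (y j))"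
  shows "i \<le> n \<Longrightarrow> x \<in> dom_pow D A i \<and> (\<lambda>j. (A ^^ i) (y j)) \<longlonglongrightarrow> (A ^^ i) x"
proof (induction i)
  case 0 thus ?case using lim by simp
next
  case (Suc i)
  obtain s where s: "(\<lambda>j. (A ^^ Suc i) (y j)) \<longlonglongrightarrow> s" using conv[OF Suc.prems] by (auto simp: convergent_def)
  have lim: "(\<lambda>j. ((A ^^ i) (y j), A ((A ^^ i) (y j)))) \<longlonglongrightarrow> ((A ^^ i) x, s)"
    using Suc s by (intro tendsto_Pair) auto
  have mem: "((A ^^ i) (y j), A ((A ^^ i) (y j))) \<in> {(x, A x) | x. x \<in> D}" for j
    using y by (auto simp: C_infty_iff)
  have "((A ^^ i) x, s) \<in> {(x, A x) | x. x \<in> D}"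
    by (rule closed_sequentially[OF graph_closed mem lim])
  thus ?case using Suc s by auto
qed

text \<open>
The infimum need not be attained; the factor \<open>2\<close> is available because the bound is strictly positive.
\<close>

lemma near_best_sequence:
  assumes \<omega>: "modulus_type \<omega>" "\<exists>t\<in>{0..1}. \<omega> t \<noteq> 0" and m: "m > 0"
    and best: "\<forall>r\<ge>1. best_approx r x D A \<le> m / r ^ n * \<omega> (1 / r)"
  obtains y :: "nat \<Rightarrow> 'a" where "\<And>j. y j \<in> Xi (2 ^ j) D A"
    "\<And>j. norm (x - y j) \<le> 2 * m * (1/2) ^ (j * n) * \<omega> ((1/2) ^ j)"
proof -
  have "\<exists>y. y \<in> Xi (2 ^ j) D A \<and> norm (x - y) \<le> 2 * m * (1/2) ^ (j * n) * \<omega> ((1/2) ^ j)" for j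
  proof -
    define B where "B = m * (1/2) ^ (j * n) * \<omega> ((1/2) ^ j)"
    have "B > 0" unfolding B_def using m modulus_type_pos[OF \<omega>] by simp
    have "best_approx (2 ^ j) x D A \<le> B"
      using best[rule_format, of "2 ^ j"] by (simp add: B_def power_mult power_divide)
    hence lt: "(INF y\<in>Xi (2 ^ j) D A. norm (x - y)) < 2 * B" unfolding best_approx_def using \<open>B > 0\<close> by linarith
    have ne: "(\<lambda>y. norm (x - y)) ` Xi (2 ^ j) D A \<noteq> {}" using zero_in_Xi[of "2 ^ j"] by auto
    from cInf_lessD[OF ne lt] obtain y where "y \<in> Xi (2 ^ j) D A" "norm (x - y) < 2 * B" by blast
    thus ?thesis unfolding B_def by (intro exI[of _ y]) (auto simp: mult_ac)
  qed
  thus ?thesis using that by metis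
qed

text \<open>
Bernstein's inequality applied to the increments, which have type at most \<open>2 ^ Suc j\<close>. Up to order
\<open>n\<close> the decay of the approximation compensates the powers of the type; beyond it
the factor \<open>2 ^ (j * i)\<close> remains.
\<close>

lemma dyadic_increment_bound:
  assumes \<omega>: "modulus_type \<omega>" and m: "m > 0" and y: "\<And>j. y j \<in> Xi (2 ^ j) D A"
    "\<And>j. norm (x - y j) \<le> 2 * m * (1/2) ^ (j * n) * \<omega> ((1/2) ^ j)"
  obtains E :: "nat \<Rightarrow> real" where "\<And>i. E i > 0"
    "\<And>i j. norm ((A ^^ (i + n)) (y (Suc j) - y j)) \<le> E (i + n) * (2 ^ (j * i) * \<omega> ((1/2) ^ j))"
    "\<And>i j. i \<le> n \<Longrightarrow> norm ((A ^^ i) (y (Suc j) - y j)) \<le> E i * \<omega> ((1/2) ^ j)"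
proof -
  obtain C where C: "C > 0" "\<And>r y k. r \<ge> 1 \<Longrightarrow> y \<in> Xi r D A \<Longrightarrow> norm ((A ^^ k) y) \<le> C * fact k * r ^ k * norm y"
    using Bernstein_inequality by blast
  define E where "E i = C * fact i * 2 ^ i * (4 * m)" for i :: nat
  have w: "\<omega> ((1/2) ^ j) \<ge> 0" for j by (intro modulus_type_nonneg[OF \<omega>]) auto
  have main: "norm ((A ^^ i) (y (Suc j) - y j)) \<le> E i * (2 ^ (j * i) * (1/2) ^ (j * n) * \<omega> ((1/2) ^ j))" for i j
  proof -
    have X: "y (Suc j) - y j \<in> Xi (2 ^ Suc j) D A"
      using y(1)[of j] y(1)[of "Suc j"] Xi_mono[of "2 ^ j" "2 ^ Suc j" D A] by (intro Xi_diff) auto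
    have "norm (y (Suc j) - y j) \<le> norm (x - y j) + norm (x - y (Suc j))"
      using norm_triangle_ineq4[of "x - y j" "x - y (Suc j)"] by simp
    also have "norm (x - y (Suc j)) \<le> 2 * m * (1/2) ^ (Suc j * n) * \<omega> ((1/2) ^ Suc j)" by (rule y)
    also have "\<dots> \<le> 2 * m * (1/2) ^ (j * n) * \<omega> ((1/2) ^ j)"
      using m w by (intro mult_mono mult_left_mono power_decreasing modulus_type_mono[OF \<omega>])
        (auto simp del: power_Suc intro: power_decreasing)
    also have "norm (x - y j) \<le> 2 * m * (1/2) ^ (j * n) * \<omega> ((1/2) ^ j)" by (rule y)
    finally have d: "norm (y (Suc j) - y j) \<le> 4 * m * (1/2) ^ (j * n) * \<omega> ((1/2) ^ j)" by (simp add: mult_ac)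
    have "norm ((A ^^ i) (y (Suc j) - y j)) \<le> C * fact i * (2 ^ Suc j) ^ i * norm (y (Suc j) - y j)"
      using X by (intro C(2)) (auto simp: one_le_power simp del: power_Suc)
    also have "\<dots> \<le> C * fact i * (2 ^ Suc j) ^ i * (4 * m * (1/2) ^ (j * n) * \<omega> ((1/2) ^ j))"
      using C(1) by (intro mult_left_mono d) auto
    also have "\<dots> = E i * (2 ^ (j * i) * (1/2) ^ (j * n) * \<omega> ((1/2) ^ j))"
      by (simp add: E_def power_mult power_mult_distrib)
    finally show ?thesis .
  qed
  show ?thesis
  proof (rule that[of E])
    show E0: "E i > 0" for i using C m by (simp add: E_def)
    show "norm ((A ^^ (i + n)) (y (Suc j) - y j)) \<le> E (i + n) * (2 ^ (j * i) * \<omega> ((1/2) ^ j))" for i j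
    proof -
      have "(2::real) ^ (j * (i + n)) * (1/2) ^ (j * n) = 2 ^ (j * i)"
        by (simp add: distrib_left power_add power_divide)
      thus ?thesis using main[where i="i + n" and j=j] by simp
    qed
    show "norm ((A ^^ i) (y (Suc j) - y j)) \<le> E i * \<omega> ((1/2) ^ j)" if "i \<le> n" for i j
    proof -
      have "(2::real) ^ (j * i) \<le> 2 ^ (j * n)" using that by (intro power_increasing) auto
      hence "2 ^ (j * i) * (1/2) ^ (j * n) \<le> (1::real)" by (simp add: power_divide)
      from mult_right_mono[OF this w[of j]] have "2 ^ (j * i) * (1/2) ^ (j * n) * \<omega> ((1/2) ^ j) \<le> \<omega> ((1/2) ^ j)" by simp
      from mult_left_mono[OF this less_imp_le[OF E0[of i]]] show ?thesis using main[of i j] by linarith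
    qed
  qed
qed

lemma summable_modulus:
  assumes \<omega>: "modulus_type \<omega>"
  shows "summable (\<lambda>j. \<omega> ((1/2) ^ j))"
proof -
  obtain c where c: "c > 0" "\<And>t. 0 \<le> t \<Longrightarrow> t \<le> 1 \<Longrightarrow> \<omega> (2 * t) \<le> c * \<omega> t"
    using modulus_type_doubling[OF \<omega>] by blast
  show ?thesis
  proof (rule summableI_nonneg_bounded)
    show "0 \<le> \<omega> ((1/2) ^ j)" for j by (intro modulus_type_nonneg[OF \<omega>]) auto
    show "(\<Sum>j<N. \<omega> ((1/2) ^ j)) \<le> 2 * c\<^sup>2 * (LBINT u:{0<..1}. \<omega> u / u)" for N
      using high_frequency_sum[OF \<omega> c, of 1 0 N] by (simp add: lessThan_atLeast0)
  qed
qed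

lemma inverse_theorem_domain:
  assumes \<omega>: "modulus_type \<omega>" and m: "m > 0" and y: "\<And>j. y j \<in> Xi (2 ^ j) D A"
    "\<And>j. norm (x - y j) \<le> 2 * m * (1/2) ^ (j * n) * \<omega> ((1/2) ^ j)"
  shows "x \<in> dom_pow D A n \<and> (\<lambda>j. (A ^^ n) (y j)) \<longlonglongrightarrow> (A ^^ n) x"
proof -
  obtain E :: "nat \<Rightarrow> real" where E: "\<And>i j. i \<le> n \<Longrightarrow> norm ((A ^^ i) (y (Suc j) - y j)) \<le> E i * \<omega> ((1/2) ^ j)"
    using dyadic_increment_bound[OF \<omega> m y] by metis
  have yC: "y j \<in> C_infty D A" for j using y(1) Xi_imp_C_infty by blast
  show ?thesis
  proof (rule funpow_A_tendsto[OF yC _ _ order_refl])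
    have w1: "\<omega> ((1/2) ^ j) \<le> \<omega> 1" for j by (intro modulus_type_mono[OF \<omega>]) (auto simp: power_le_one)
    have le: "norm (y j - x) \<le> 2 * m * \<omega> ((1/2) ^ j)" for j
    proof -
      have "2 * m * (1/2) ^ (j * n) * \<omega> ((1/2) ^ j) \<le> 2 * m * 1 * \<omega> ((1/2) ^ j)"
        using m modulus_type_nonneg[OF \<omega>, of "(1/2) ^ j"] by (intro mult_right_mono mult_left_mono) (auto simp: power_le_one)
      thus ?thesis using y(2)[of j] by (simp add: norm_minus_commute)
    qed
    have w_lim: "(\<lambda>j. 2 * m * \<omega> ((1/2) ^ j)) \<longlonglongrightarrow> 0"
      using summable_LIMSEQ_zero[OF summable_modulus[OF \<omega>]] by (rule tendsto_mult_right_zero)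
    have "(\<lambda>j. y j - x) \<longlonglongrightarrow> 0"
      by (rule Lim_null_comparison[OF _ w_lim]) (simp add: le)
    thus "y \<longlonglongrightarrow> x" by (simp add: LIM_zero_iff)
    show "convergent (\<lambda>j. (A ^^ i) (y j))" if i: "i \<le> n" for i
    proof -
      have "summable (\<lambda>j. (A ^^ i) (y (Suc j)) - (A ^^ i) (y j))"
      proof (rule summable_comparison_test'[of _ 0])
        show "summable (\<lambda>j. E i * \<omega> ((1/2) ^ j))" using summable_modulus[OF \<omega>] by (rule summable_mult)
        show "norm ((A ^^ i) (y (Suc j)) - (A ^^ i) (y j)) \<le> E i * \<omega> ((1/2) ^ j)" for j
          using E[OF i, of j] by (simp add: funpow_A_diff yC)
      qed
      hence "convergent (\<lambda>N. \<Sum>j<N. (A ^^ i) (y (Suc j)) - (A ^^ i) (y j))" by (simp add: summable_iff_convergent)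
      hence "convergent (\<lambda>N. (A ^^ i) (y N) - (A ^^ i) (y 0))" by (simp only: sum_lessThan_telescope[of "\<lambda>j. (A ^^ i) (y j)"])
      thus ?thesis using convergent_diff_const_right_iff[of "\<lambda>N. (A ^^ i) (y N)" "(A ^^ i) (y 0)"] by simp
    qed
  qed
qed

text \<open>
The differences of \<open>A\<^sup>n y\<^sub>N\<close> are estimated uniformly in \<open>N\<close> and then pass to the limit, so that only finite
sums occur. Frequencies below \<open>J\<close>, where \<open>(1/2) ^ J \<approx> t\<close>, are estimated by
\<open>group_diff_smooth\<close> and the others by \<open>group_diff_bounded\<close>.
\<close>

lemma inverse_theorem_modulus:
  assumes \<omega>: "modulus_type \<omega>" "\<exists>t\<in>{0..1}. \<omega> t \<noteq> 0" and m: "m > 0" and y: "\<And>j. y j \<in> Xi (2 ^ j) D A"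
    "\<And>j. norm (x - y j) \<le> 2 * m * (1/2) ^ (j * n) * \<omega> ((1/2) ^ j)"
    and lim: "(\<lambda>j. (A ^^ n) (y j)) \<longlonglongrightarrow> v"
  shows "\<exists>M>0. \<forall>t. 0 < t \<and> t \<le> 1/2 \<longrightarrow> modulus_of_continuity k t v U
    \<le> M * (t ^ k * (LBINT u:{t..1}. \<omega> u / u ^ (k + 1)) + (LBINT u:{0<..t}. \<omega> u / u))"
proof -
  obtain E :: "nat \<Rightarrow> real" where E: "\<And>i. E i > 0"
    "\<And>i j. norm ((A ^^ (i + n)) (y (Suc j) - y j)) \<le> E (i + n) * (2 ^ (j * i) * \<omega> ((1/2) ^ j))"
    using dyadic_increment_bound[OF \<omega>(1) m y] by metis
  obtain a :: "nat \<Rightarrow> real" where a: "\<And>t j x. \<bar>t\<bar> \<le> 2 ^ j \<Longrightarrow> norm (U t x) \<le> exp (a j) * norm x"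
    using growth_sequence by metis
  define K where "K = exp (a 0)"
  have K: "norm (U t x) \<le> K * norm x" if "\<bar>t\<bar> \<le> 1" for t x using a[of t 0 x] that by (simp add: K_def)
  have K0: "K > 0" by (simp add: K_def)
  obtain c where c: "c > 0" "\<And>t. 0 \<le> t \<Longrightarrow> t \<le> 1 \<Longrightarrow> \<omega> (2 * t) \<le> c * \<omega> t"
    using modulus_type_doubling[OF \<omega>(1)] by blast
  have yC: "y j \<in> C_infty D A" for j using y(1) Xi_imp_C_infty by blast
  have w0: "\<omega> ((1/2) ^ j) \<ge> 0" for j by (intro modulus_type_nonneg[OF \<omega>(1)]) auto
  have w1: "\<omega> 1 > 0" using modulus_type_pos[OF \<omega>] by simp
  define Y where "Y = norm ((A ^^ (k + n)) (y 0))"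
  define M1 where "M1 = K ^ k * (Y / \<omega> 1 + E (k + n)) * (2 * c)"
  define M2 where "M2 = (K + 1) ^ k * E n * (2 * c\<^sup>2)"
  have M0: "M1 > 0" "M2 > 0" unfolding M1_def M2_def using K0 E(1) c(1) w1
    by (auto intro!: mult_pos_pos add_nonneg_pos simp: Y_def)
  have est: "norm (group_diff U k \<tau> v) \<le> (M1 + M2) * (t ^ k * (LBINT u:{t..1}. \<omega> u / u ^ (k + 1)) + (LBINT u:{0<..t}. \<omega> u / u))"
    if t: "0 < t" "t \<le> 1/2" and \<tau>: "0 \<le> \<tau>" "\<tau> \<le> t" for t \<tau>
  proof -
    define L where "L = (LBINT u:{t..1}. \<omega> u / u ^ (k + 1))"
    define H where "H = (LBINT u:{0<..t}. \<omega> u / u)"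
    have \<tau>1: "\<tau> \<le> 1" "\<bar>\<tau>\<bar> \<le> 1" using t \<tau> by auto
    obtain J where J: "J \<ge> 1" "(1/2) ^ Suc J \<le> t" "t \<le> (1/2) ^ J"
    proof -
      obtain N where N: "(1/2) ^ N < t" using real_arch_pow_inv[of t "1/2"] t by auto
      define m where "m = (LEAST N. (1/2) ^ N < t)"
      have m: "(1/2) ^ m < t" unfolding m_def using N by (rule LeastI)
      have "m \<noteq> 0" "m \<noteq> 1" using m t by (intro notI; simp)+
      then obtain J where J: "m = Suc J" "J \<ge> 1" by (cases m) auto
      have "\<not> (1/2) ^ J < t" using not_less_Least[of J "\<lambda>N. (1/2) ^ N < t"] J(1) unfolding m_def by simp
      thus ?thesis using that[of J] m J by simp
    qed
    define f where "f j = group_diff U k \<tau> ((A ^^ n) (y j))" for j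
    define d where "d j = (A ^^ n) (y (Suc j) - y j)" for j
    have dC: "d j \<in> C_infty D A" for j unfolding d_def by (intro C_infty_funpow C_infty_diff yC)
    have fd: "f (Suc j) - f j = group_diff U k \<tau> (d j)" for j
      unfolding f_def d_def funpow_A_diff[OF yC yC] linear_group_diff ..
    have smooth: "norm (group_diff U k \<tau> ((A ^^ n) w)) \<le> K ^ k * t ^ k * norm ((A ^^ (k + n)) w)"
      if w: "w \<in> C_infty D A" for w
    proof -
      have "norm (group_diff U k \<tau> ((A ^^ n) w)) \<le> (K * \<tau>) ^ k * norm ((A ^^ k) ((A ^^ n) w))"
        using K K0 \<tau> \<tau>1 C_infty_funpow[OF w] by (intro group_diff_smooth) auto
      also have "\<dots> \<le> (K * t) ^ k * norm ((A ^^ k) ((A ^^ n) w))"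
        using K0 \<tau> by (intro mult_right_mono power_mono mult_left_mono) auto
      finally show ?thesis by (simp add: funpow_add power_mult_distrib)
    qed
    have bdd: "norm (group_diff U k \<tau> w) \<le> (K + 1) ^ k * norm w" for w
      using K[OF \<tau>1(2)] K0 by (intro group_diff_bounded) auto
    have low: "(\<Sum>j<J. 2 ^ (j * k) * \<omega> ((1/2) ^ j)) \<le> 2 * c * L"
      unfolding L_def using low_frequency_sum[OF \<omega>(1) c _ _ J(3)] t by simp
    have high: "(\<Sum>j=J..<N. \<omega> ((1/2) ^ j)) \<le> 2 * c\<^sup>2 * H" for N
      unfolding H_def using high_frequency_sum[OF \<omega>(1) c _ _ J(2)] t by simp
    \<comment> \<open>As \<open>t \<le> 1/2\<close> gives \<open>J \<ge> 1\<close>, the integral \<open>L\<close> is bounded below by a constant, which absorbs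
       the contribution of \<open>y 0\<close>.\<close>
    have "(\<Sum>j\<in>{0}. 2 ^ (j * k) * \<omega> ((1/2) ^ j)) \<le> (\<Sum>j<J. 2 ^ (j * k) * \<omega> ((1/2) ^ j))"
      using J(1) w0 by (intro sum_mono2) auto
    hence first: "\<omega> 1 \<le> 2 * c * L" using low by simp
    have L0: "L \<ge> 0"
    proof -
      have "0 < 2 * c * L" using first w1 by linarith
      thus ?thesis using c(1) by (simp add: zero_less_mult_iff)
    qed
    have H0: "H \<ge> 0"
      using high[of J] c(1) by (simp add: zero_le_mult_iff)
    have f0: "norm (f 0) \<le> K ^ k * t ^ k * (Y / \<omega> 1) * (2 * c * L)"
    proof -
      have "norm (f 0) \<le> K ^ k * t ^ k * Y" unfolding f_def Y_def by (rule smooth[OF yC])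
      also have "Y = Y / \<omega> 1 * \<omega> 1" using w1 by simp
      also have "K ^ k * t ^ k * (Y / \<omega> 1 * \<omega> 1) \<le> K ^ k * t ^ k * (Y / \<omega> 1 * (2 * c * L))"
        using K0 t w1 first by (intro mult_left_mono) (auto simp: Y_def)
      finally show ?thesis by (simp add: mult_ac)
    qed
    have fN: "norm (f N) \<le> (M1 + M2) * (t ^ k * L + H)" if "N \<ge> J" for N
    proof -
      have "f N = f 0 + (\<Sum>j<N. f (Suc j) - f j)" by (simp add: sum_lessThan_telescope)
      hence "norm (f N) \<le> norm (f 0) + (\<Sum>j<N. norm (f (Suc j) - f j))"
        by (metis norm_triangle_le add_left_mono norm_sum)
      also have "(\<Sum>j<N. norm (f (Suc j) - f j)) = (\<Sum>j<J. norm (f (Suc j) - f j)) + (\<Sum>j=J..<N. norm (f (Suc j) - f j))"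
        using that by (simp add: lessThan_atLeast0 sum.atLeastLessThan_concat)
      also have "(\<Sum>j<J. norm (f (Suc j) - f j)) \<le> (\<Sum>j<J. K ^ k * t ^ k * E (k + n) * (2 ^ (j * k) * \<omega> ((1/2) ^ j)))"
      proof (rule sum_mono)
        fix j
        have "norm (f (Suc j) - f j) \<le> K ^ k * t ^ k * norm ((A ^^ (k + n)) (y (Suc j) - y j))"
          unfolding fd d_def by (intro smooth C_infty_diff yC)
        also have "\<dots> \<le> K ^ k * t ^ k * (E (k + n) * (2 ^ (j * k) * \<omega> ((1/2) ^ j)))"
          using K0 t by (intro mult_left_mono E) auto
        finally show "norm (f (Suc j) - f j) \<le> K ^ k * t ^ k * E (k + n) * (2 ^ (j * k) * \<omega> ((1/2) ^ j))" by (simp add: mult_ac)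
      qed
      also have "\<dots> \<le> K ^ k * t ^ k * E (k + n) * (2 * c * L)"
        unfolding sum_distrib_left[symmetric] using K0 t E(1)[of "k + n"] by (intro mult_left_mono low) auto
      also have "(\<Sum>j=J..<N. norm (f (Suc j) - f j)) \<le> (\<Sum>j=J..<N. (K + 1) ^ k * E n * \<omega> ((1/2) ^ j))"
      proof (rule sum_mono)
        fix j
        have "norm (f (Suc j) - f j) \<le> (K + 1) ^ k * norm (d j)" unfolding fd by (rule bdd)
        also have "\<dots> \<le> (K + 1) ^ k * (E n * \<omega> ((1/2) ^ j))"
          using K0 E(2)[of 0 j] unfolding d_def by (intro mult_left_mono) auto
        finally show "norm (f (Suc j) - f j) \<le> (K + 1) ^ k * E n * \<omega> ((1/2) ^ j)" by (simp add: mult_ac)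
      qed
      also have "\<dots> \<le> (K + 1) ^ k * E n * (2 * c\<^sup>2 * H)"
        unfolding sum_distrib_left[symmetric] using K0 E(1)[of n] by (intro mult_left_mono high) auto
      finally have "norm (f N) \<le> K ^ k * t ^ k * (Y / \<omega> 1) * (2 * c * L)
          + (K ^ k * t ^ k * E (k + n) * (2 * c * L) + (K + 1) ^ k * E n * (2 * c\<^sup>2 * H))" using f0 by simp
      also have "\<dots> = M1 * (t ^ k * L) + M2 * H" unfolding M1_def M2_def by algebra
      also have "\<dots> \<le> (M1 + M2) * (t ^ k * L) + (M1 + M2) * H"
        using M0 L0 H0 t by (intro add_mono mult_right_mono) auto
      finally show ?thesis by (simp add: distrib_left)
    qed
    have "(\<lambda>N. group_diff U k \<tau> v - f N) \<longlonglongrightarrow> 0"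
    proof (rule Lim_null_comparison)
      show "\<forall>\<^sub>F N in sequentially. norm (group_diff U k \<tau> v - f N) \<le> (K + 1) ^ k * norm (v - (A ^^ n) (y N))"
        unfolding f_def linear_group_diff[symmetric] using bdd by simp
      have "(\<lambda>N. v - (A ^^ n) (y N)) \<longlonglongrightarrow> v - v" using lim by (intro tendsto_intros)
      thus "(\<lambda>N. (K + 1) ^ k * norm (v - (A ^^ n) (y N))) \<longlonglongrightarrow> 0"
        by (intro tendsto_mult_right_zero tendsto_norm_zero) simp
    qed
    hence "(\<lambda>N. group_diff U k \<tau> v - (group_diff U k \<tau> v - f N)) \<longlonglongrightarrow> group_diff U k \<tau> v - 0"
      by (intro tendsto_intros)
    hence "f \<longlonglongrightarrow> group_diff U k \<tau> v" by simp
    from tendsto_norm[OF this] have "norm (group_diff U k \<tau> v) \<le> (M1 + M2) * (t ^ k * L + H)"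
      by (rule tendsto_upperbound[OF _ eventually_sequentiallyI[OF fN]]) simp_all
    thus ?thesis unfolding L_def H_def .
  qed
  show ?thesis
  proof (intro exI[of _ "M1 + M2"] conjI allI impI)
    show "M1 + M2 > 0" using M0 by simp
    fix t :: real assume t: "0 < t \<and> t \<le> 1/2"
    show "modulus_of_continuity k t v U \<le> (M1 + M2) * (t ^ k * (LBINT u:{t..1}. \<omega> u / u ^ (k + 1)) + (LBINT u:{0<..t}. \<omega> u / u))"
      unfolding modulus_of_continuity_def using t est[of t] by (intro cSUP_least) auto
  qed
qed

end

theorem theorem3:
  fixes U :: "real \<Rightarrow> 'a::complex_banach \<Rightarrow> 'a"
    and D :: "'a set"
    and A :: "'a \<Rightarrow> 'a"
    and \<omega> :: "real \<Rightarrow> real"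
    and x :: 'a
    and n :: nat
    and m :: real
  assumes "closed_densely_defined D A"
    and "c0_group U"
    and "is_generator D (\<lambda>y. \<i> *C A y) U"
    and "nonquasianalytic U"
    and "modulus_type \<omega>"
    and "\<exists>t\<in>{0..1}. \<omega> t \<noteq> 0"
    and "n \<ge> 1" and "m > 0"
    and "\<forall>r\<ge>1. best_approx r x D A \<le> m / r ^ n * \<omega> (1 / r)"
  shows "x \<in> dom_pow D A n \<and>
    (\<forall>k\<ge>1. \<exists>m\<^sub>k>0. \<forall>t. 0 < t \<and> t \<le> 1 / 2 \<longrightarrow>
      modulus_of_continuity k t ((A ^^ n) x) U
        \<le> m\<^sub>k * (t ^ k * (LBINT u:{t..1}. \<omega> u / u ^ (k + 1)) + (LBINT u:{0<..t}. \<omega> u / u)))"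
proof -
  interpret nonquasianalytic_group D A U
    using assms(1-4) by unfold_locales
  obtain y :: "nat \<Rightarrow> 'a" where y: "\<And>j. y j \<in> Xi (2 ^ j) D A"
    "\<And>j. norm (x - y j) \<le> 2 * m * (1/2) ^ (j * n) * \<omega> ((1/2) ^ j)"
    using near_best_sequence[OF assms(5,6,8,9)] by blast
  have "x \<in> dom_pow D A n" and lim: "(\<lambda>j. (A ^^ n) (y j)) \<longlonglongrightarrow> (A ^^ n) x"
    using inverse_theorem_domain[OF assms(5,8) y] by blast+
  thus ?thesis using inverse_theorem_modulus[OF assms(5,6,8) y lim] by blast
qed

end
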